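(* Suppose that $\ell:\mathbb{R}\to\mathbb{R}$ is upper semicontinuous. Suppose that the transport cost $c:\mathbb{R}^d\times\mathbb{R}^d\to\mathbb{R}_+$ is of the form $c(x,x')=(x-x')^TA(x)(x-x')$, where $A:\mathbb{R}^d\to\mathbb{S}_d^{++}$ is such that $c$ is lower semicontinuous and there exist positive constants $\rho_{\min},\rho_{\max}$ with $\sup_{\|v\|=1}v^TA(x)v\le\rho_{\max}$ and $\inf_{\|v\|=1}v^TA(x)v\ge\rho_{\min}$ for $P_0$-almost every $x\in\mathbb{R}^d$. Then the worst-case objective satisfies, for $\beta\in B$, $$\sup_{P:\,D_c(P_0,P)\le\delta}E_P[\ell(\beta^TX)]=\inf_{\lambda\ge0}f_\delta(\beta,\lambda),$$ where $f_\delta(\beta,\lambda):=E_{P_0}[\ell_{rob}(\beta,\lambda;X)]$, $\ell_{rob}(\beta,\lambda;x):=\sup_{\gamma\in\mathbb{R}}F(\gamma,\beta,\lambda;x)$ and $$F(\gamma,\beta,\lambda;x):=\ell\big(\beta^Tx+\gamma\sqrt\delta\,\beta^TA(x)^{-1}\beta\big)-\lambda\sqrt\delta\,\big(\gamma^2\beta^TA(x)^{-1}\beta-1\big).$$ For any $\beta\in B$, there exists a dual optimizer $\lambda_*(\beta)\ge0$ such that $f_\delta(\beta,\lambda_*(\beta))=\inf_{\lambda\ge0}f_\delta(\beta,\lambda)$.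
   Context: Let $d\ge1$, let $B\subseteq\mathbb{R}^d$ be a convex set, $\delta>0$, and let $P_0$ be a Borel probability measure on $\mathbb{R}^d$ (a general standing assumption, not specified further, is that $P_0$ is an arbitrary distribution with suitably bounded moments). $\mathbb{S}_d^{++}$ is the set of real symmetric positive definite $d\times d$ matrices, $\mathbb{R}_+=[0,\infty)$, and $\|\cdot\|$ is the Euclidean norm. For a Borel probability measure $P$ on $\mathbb{R}^d$, the optimal transport cost is $$D_c(P_0,P)=\inf\{E_\pi[c(X,X')]:\pi\text{ a Borel probability measure on }\mathbb{R}^d\times\mathbb{R}^d\text{ with first marginal }P_0\text{ and second marginal }P\}.$$ $E_P$ denotes expectation with $X\sim P$, and $E_{P_0}$ expectation with $X\sim P_0$. The function $f_\delta$ may take the value $+\infty$. *)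

theory Defs
  imports "HOL-Probability.Probability"
begin

definition usc :: "('a::topological_space \<Rightarrow> real) \<Rightarrow> bool" where
  "usc f \<longleftrightarrow> (\<forall>x a. f x < a \<longrightarrow> (\<forall>\<^sub>F y in nhds x. f y < a))"

definition lsc :: "('a::topological_space \<Rightarrow> real) \<Rightarrow> bool" where
  "lsc f \<longleftrightarrow> (\<forall>x a. a < f x \<longrightarrow> (\<forall>\<^sub>F y in nhds x. a < f y))"

definition spd :: "real^'n^'n \<Rightarrow> bool" where
  "spd M \<longleftrightarrow> transpose M = M \<and> (\<forall>v. v \<noteq> 0 \<longrightarrow> 0 < v \<bullet> (M *v v))"

definition borel_prob :: "'a::topological_space measure \<Rightarrow> bool" where
  "borel_prob P \<longleftrightarrow> prob_space P \<and> sets P = sets borel"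

text \<open>
  Expectation of an extended-real function, as the integral of its positive part minus that of
  its negative part. If both parts have infinite integral, then the value is \<open>\<infinity>\<close>, because
  \<open>\<infinity> - \<infinity> = \<infinity>\<close> in \<^typ>\<open>ereal\<close>; this is the usual convention when the expectation is an
  objective to be minimised. (The Bochner integral would return 0 there and for
  every integral that is infinite.)
\<close>

definition expect :: "'a measure \<Rightarrow> ('a \<Rightarrow> ereal) \<Rightarrow> ereal" where
  "expect P g = enn2ereal (\<integral>\<^sup>+ x. e2ennreal (g x) \<partial>P) - enn2ereal (\<integral>\<^sup>+ x. e2ennreal (- g x) \<partial>P)"

definition couplings ::
  "'a::topological_space measure \<Rightarrow> 'b::topological_space measure \<Rightarrow> ('a \<times> 'b) measure set" where
  "couplings P Q = {\<pi>. borel_prob \<pi> \<and> distr \<pi> borel fst = P \<and> distr \<pi> borel snd = Q}"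

definition transport_cost ::
  "('a::topological_space \<Rightarrow> 'a \<Rightarrow> real) \<Rightarrow> 'a measure \<Rightarrow> 'a measure \<Rightarrow> ennreal" where
  "transport_cost c P Q = (INF \<pi>\<in>couplings P Q. \<integral>\<^sup>+ z. ennreal (c (fst z) (snd z)) \<partial>\<pi>)"

definition worst_case ::
  "(real \<Rightarrow> real) \<Rightarrow> (real^'n \<Rightarrow> real^'n \<Rightarrow> real) \<Rightarrow> (real^'n) measure \<Rightarrow> real \<Rightarrow> real^'n \<Rightarrow> ereal" where
  "worst_case l c P\<^sub>0 \<delta> \<beta> =
     (SUP P\<in>{P. borel_prob P \<and> transport_cost c P\<^sub>0 P \<le> ennreal \<delta>}. expect P (\<lambda>x. ereal (l (\<beta> \<bullet> x))))"

definition F ::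
  "(real \<Rightarrow> real) \<Rightarrow> (real^'n \<Rightarrow> real^'n^'n) \<Rightarrow> real \<Rightarrow> real \<Rightarrow> real^'n \<Rightarrow> real \<Rightarrow> real^'n \<Rightarrow> real" where
  "F l A \<delta> \<gamma> \<beta> lam x =
     l (\<beta> \<bullet> x + \<gamma> * sqrt \<delta> * (\<beta> \<bullet> (matrix_inv (A x) *v \<beta>)))
     - lam * sqrt \<delta> * (\<gamma>\<^sup>2 * (\<beta> \<bullet> (matrix_inv (A x) *v \<beta>)) - 1)"

definition l_rob ::
  "(real \<Rightarrow> real) \<Rightarrow> (real^'n \<Rightarrow> real^'n^'n) \<Rightarrow> real \<Rightarrow> real^'n \<Rightarrow> real \<Rightarrow> real^'n \<Rightarrow> ereal" where
  "l_rob l A \<delta> \<beta> lam x = (SUP \<gamma>. ereal (F l A \<delta> \<gamma> \<beta> lam x))"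

definition f_dual ::
  "(real \<Rightarrow> real) \<Rightarrow> (real^'n \<Rightarrow> real^'n^'n) \<Rightarrow> (real^'n) measure \<Rightarrow> real \<Rightarrow> real^'n \<Rightarrow> real \<Rightarrow> ereal" where
  "f_dual l A P\<^sub>0 \<delta> \<beta> lam = expect P\<^sub>0 (l_rob l A \<delta> \<beta> lam)"

end

theory Submission
  imports Defs
begin

text \<open>
  Moving \<open>x\<close> so that \<open>\<beta> \<bullet> x\<close> changes by a prescribed amount is cheapest along
  \<open>A(x)\<^sup>-\<^sup>1 \<beta>\<close>, by Cauchy-Schwarz for the form of \<open>A(x)\<close>; so \<open>l_rob\<close> is the pointwise supremum over
  \<open>x'\<close> of \<open>l (\<beta> \<bullet> x') - \<mu> (c x x' - \<delta>)\<close> with \<open>\<mu> = \<lambda> / sqrt \<delta>\<close>, and integrating this bound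
  over couplings gives weak duality. Conversely, mixtures of couplings make the optimal value a
  concave function of the budget, finite below \<open>\<delta>\<close>, and a supergradient at \<open>\<delta>\<close> is an optimal
  multiplier: measurable maximisers of \<open>F\<close> over \<open>\<bar>\<gamma>\<bar> \<le> m\<close> are couplings of finite cost that
  exhaust \<open>l_rob\<close> by monotone convergence.

  The integrals may be infinite, so three cases arise. If \<open>f_dual\<close> is \<open>-\<infinity>\<close> somewhere, weak duality
  suffices. If it is \<open>\<infinity>\<close> everywhere, the argument applied to the positive part of \<open>l\<close> gives
  couplings with unbounded gain, and a mixture of them has infinite gain. Otherwise a near maximiser
  of \<open>F\<close> has finite cost, and moving only the points with \<open>\<bar>l (\<beta> \<bullet> x)\<bar>\<close> large makes that
  cost smaller than \<open>\<delta>\<close>.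
\<close>

subsection \<open>Upper semicontinuous functions and supergradients\<close>

lemma open_usc_less: "usc f \<Longrightarrow> open {x. f x < a}"
  unfolding usc_def eventually_nhds by (intro Topological_Spaces.openI) (metis mem_Collect_eq subsetI)

lemma closed_usc_ge: "usc f \<Longrightarrow> closed {x. a \<le> f x}"
  using open_usc_less[of f a] by (simp add: closed_def Collect_neg_eq[symmetric] not_le)

lemma usc_borel_measurable: "usc f \<Longrightarrow> f \<in> borel_measurable borel"
  by (rule borel_measurableI_less) (simp add: open_usc_less)

lemma lsc_borel_measurable: "lsc f \<Longrightarrow> f \<in> borel_measurable borel"
proof (rule borel_measurableI_greater)
  fix a assume "lsc f"
  then have "open {x. a < f x}"
    unfolding lsc_def eventually_nhds by (intro Topological_Spaces.openI) (metis mem_Collect_eq subsetI)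
  then show "{x \<in> space borel. a < f x} \<in> sets borel" by simp
qed

lemma usc_compose:
  assumes "usc f" "continuous_on UNIV g" shows "usc (\<lambda>x. f (g x))"
  unfolding usc_def
proof (intro allI impI)
  fix x a assume "f (g x) < a"
  then have "\<forall>\<^sub>F y in nhds (g x). f y < a" using assms(1) by (simp add: usc_def)
  moreover have "filterlim g (nhds (g x)) (nhds x)"
    using assms(2) by (simp add: continuous_on_def tendsto_at_iff_tendsto_nhds)
  ultimately show "\<forall>\<^sub>F y in nhds x. f (g y) < a"
    by (rule eventually_compose_filterlim)
qed

lemma usc_add_continuous:
  assumes "usc f" "continuous_on UNIV g" shows "usc (\<lambda>x. f x + g x :: real)"
  unfolding usc_def
proof (intro allI impI)
  fix x a assume less: "f x + g x < a"
  define e where "e = (a - f x - g x) / 2"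
  have "\<forall>\<^sub>F y in nhds x. f y < f x + e"
    using assms(1) less by (auto simp: usc_def e_def)
  moreover have "\<forall>\<^sub>F y in nhds x. g y < g x + e"
  proof -
    have "open {y. g y < g x + e}" using assms(2) by (simp add: open_Collect_less)
    then show ?thesis using less by (auto simp: eventually_nhds e_def)
  qed
  ultimately show "\<forall>\<^sub>F y in nhds x. f y + g y < a"
    by eventually_elim (simp add: e_def field_simps)
qed

text \<open>Without a maximiser the open sets \<open>{x. f x < f y}\<close> with y in K cover K. In
  a finite subcover the index with the largest value lies in none of them.\<close>

lemma usc_attains_max:
  assumes "usc f" "compact K" "K \<noteq> {}"
  obtains x where "x \<in> K" "\<And>y. y \<in> K \<Longrightarrow> f y \<le> f x"
proof -
  have "\<exists>x\<in>K. \<forall>y\<in>K. f y \<le> f x"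
  proof (rule ccontr)
    assume "\<not> ?thesis"
    then have "K \<subseteq> (\<Union>y\<in>K. {x. f x < f y})" by (auto simp: not_le)
    then obtain D where D: "D \<subseteq> K" "finite D" "K \<subseteq> (\<Union>y\<in>D. {x. f x < f y})"
      using compactE_image[OF assms(2), of K "\<lambda>y. {x. f x < f y}"] open_usc_less[OF assms(1)] by blast
    with \<open>K \<noteq> {}\<close> have "D \<noteq> {}" by auto
    then have "Max (f ` D) \<in> f ` D" using D(2) by simp
    then obtain y where "y \<in> D" "f y = Max (f ` D)" by auto
    then have y: "y \<in> K" "\<And>z. z \<in> D \<Longrightarrow> f z \<le> f y" using D by auto
    from y(1) D(3) obtain z where "z \<in> D" "f y < f z" by auto
    with y(2) show False by (simp add: leD)
  qed
  then show thesis using that by blast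
qed

text \<open>The selection is the smallest maximiser. Its measurability reduces to that of the maxima
  over \<open>{p..r}\<close> for all r: the smallest maximiser is at most a exactly when the maximum
  over \<open>{p..min a q}\<close> already reaches the one over \<open>{p..q}\<close>.\<close>

lemma usc_measurable_argmax:
  fixes h :: "real \<times> 'b::euclidean_space \<Rightarrow> real"
  assumes h: "usc h" and pq: "p \<le> q"
  obtains g where "g \<in> borel_measurable borel" "\<And>z. g z \<in> {p..q}"
    "\<And>z t. t \<in> {p..q} \<Longrightarrow> h (t, z) \<le> h (g z, z)"
proof -
  have slice: "usc (\<lambda>t. h (t, z))" for z
    by (rule usc_compose[OF h]) (intro continuous_intros)
  have ex: "\<exists>t\<in>{p..r}. \<forall>t'\<in>{p..r}. h (t', z) \<le> h (t, z)" if "p \<le> r" for r z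
  proof -
    have "{p..r} \<noteq> {}" using that by simp
    from usc_attains_max[OF slice[of z] compact_Icc this] show ?thesis by metis
  qed
  define m where "m r z = (SOME t. t \<in> {p..r} \<and> (\<forall>t'\<in>{p..r}. h (t', z) \<le> h (t, z)))" for r z
  have m: "m r z \<in> {p..r}" "t \<in> {p..r} \<Longrightarrow> h (t, z) \<le> h (m r z, z)" if "p \<le> r" for r z t
    using someI_ex[OF ex[OF that, of z, unfolded Bex_def]] by (simp_all add: m_def)
  define M where "M r z = h (m r z, z)" for r z
  have M_meas[measurable]: "M r \<in> borel_measurable borel" if "p \<le> r" for r
  proof (rule borel_measurableI_ge)
    fix a
    \<comment> \<open>A superlevel set of the partial maximum is the projection of a closed set
      along the compact interval \<open>{p..r}\<close>, hence closed.\<close>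
    have "{z. a \<le> M r z} = {z. \<exists>t. t \<in> {p..r} \<and> (t, z) \<in> {y. a \<le> h y}}"
    proof (intro Collect_cong iffI)
      fix z assume "a \<le> M r z"
      then show "\<exists>t. t \<in> {p..r} \<and> (t, z) \<in> {y. a \<le> h y}"
        using m(1)[OF that, of z] by (auto simp: M_def)
    next
      fix z assume "\<exists>t. t \<in> {p..r} \<and> (t, z) \<in> {y. a \<le> h y}"
      then obtain t where "t \<in> {p..r}" "a \<le> h (t, z)" by auto
      with m(2)[OF that, of t z] show "a \<le> M r z" by (simp add: M_def)
    qed
    also have "closed \<dots>"
      by (rule closed_compact_projection) (auto intro: closed_usc_ge[OF h])
    finally show "{z \<in> space borel. a \<le> M r z} \<in> sets borel" by simp
  qed
  define S where "S z = {t \<in> {p..q}. M q z \<le> h (t, z)}" for z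
  have S: "S z \<noteq> {}" "closed (S z)" "bdd_below (S z)" for z
  proof -
    show "S z \<noteq> {}" using m(1)[OF pq, of z] by (auto simp: S_def M_def)
    have "S z = {p..q} \<inter> {t. M q z \<le> h (t, z)}" by (auto simp: S_def)
    then show "closed (S z)" using closed_usc_ge[OF slice[of z]] by (simp add: closed_Int)
    show "bdd_below (S z)" by (auto simp: S_def intro: bdd_belowI)
  qed
  define g where "g z = Inf (S z)" for z
  have gS: "g z \<in> S z" for z
    unfolding g_def by (rule closed_contains_Inf) (rule S)+
  have "g \<in> borel_measurable borel"
  proof (rule borel_measurableI_le)
    fix a
    show "{z \<in> space borel. g z \<le> a} \<in> sets borel"
    proof (cases "a < p")
      case True
      moreover have "p \<le> g z" for z using gS[of z] by (simp add: S_def)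
      ultimately have "\<not> g z \<le> a" for z by (metis le_less_trans not_le)
      then show ?thesis by simp
    next
      case False
      then have p: "p \<le> min a q" using pq by simp
      have "{z \<in> space borel. g z \<le> a} = {z \<in> space borel. M q z \<le> M (min a q) z}"
      proof (intro Collect_cong conj_cong refl iffI)
        fix z assume "g z \<le> a"
        then have "g z \<in> {p..min a q}" using gS[of z] by (auto simp: S_def)
        from order_trans[OF _ m(2)[OF p this, of z]] gS[of z] show "M q z \<le> M (min a q) z" by (simp add: S_def M_def)
      next
        fix z assume "M q z \<le> M (min a q) z"
        then have "m (min a q) z \<in> S z" using m(1)[OF p, of z] by (auto simp: S_def M_def)
        then have "g z \<le> m (min a q) z" unfolding g_def by (rule cInf_lower) (rule S)
        then show "g z \<le> a" using m(1)[OF p, of z] by auto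
      qed
      also have "\<dots> \<in> sets borel" using M_meas[OF pq] M_meas[OF p] by measurable
      finally show ?thesis .
    qed
  qed
  moreover have "g z \<in> {p..q}" for z using gS[of z] by (simp add: S_def)
  moreover have "h (t, z) \<le> h (g z, z)" if "t \<in> {p..q}" for t z
    using m(2)[OF pq that, of z] gS[of z] by (simp add: S_def M_def)
  ultimately show thesis using that by blast
qed

text \<open>\<open>S r v\<close> is to be read as "the budget r achieves the value v". The slope k
  is the infimum of the slopes of chords from achieved points left of d to the point (d, m). The
  base point makes this set of slopes nonempty, monotonicity makes the slopes nonnegative, and
  convexity keeps every slope on the right of d below all of them.\<close>

lemma concave_supergradient:
  fixes S :: "real \<Rightarrow> real \<Rightarrow> bool"
  assumes convex: "\<And>r v r' v' t. S r v \<Longrightarrow> S r' v' \<Longrightarrow> 0 \<le> t \<Longrightarrow> t \<le> 1 \<Longrightarrow>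
      S (t * r + (1 - t) * r') (t * v + (1 - t) * v')"
    and mono: "\<And>r r' v. S r v \<Longrightarrow> r \<le> r' \<Longrightarrow> S r' v"
    and base: "S r\<^sub>0 v\<^sub>0" "r\<^sub>0 < d"
    and bound: "\<And>v. S d v \<Longrightarrow> v \<le> m"
  shows "\<exists>k\<ge>0. \<forall>r v. S r v \<longrightarrow> v \<le> m + k * (r - d)"
proof -
  define Q where "Q = {(m - v) / (d - r) | r v. S r v \<and> r < d}"
  define k where "k = Inf Q"
  have ne: "Q \<noteq> {}" using base by (auto simp: Q_def)
  have pos: "0 \<le> y" if "y \<in> Q" for y
  proof -
    from that obtain r v where "y = (m - v) / (d - r)" "S r v" "r < d" by (auto simp: Q_def)
    with bound[OF mono, of r v] show ?thesis by simp
  qed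
  then have bdd: "bdd_below Q" by (rule bdd_belowI)
  have "v \<le> m + k * (r - d)" if S: "S r v" for r v
  proof (cases r d rule: linorder_cases)
    case less
    then have "k \<le> (m - v) / (d - r)"
      unfolding k_def using S by (intro cInf_lower bdd) (auto simp: Q_def)
    then show ?thesis using less by (simp add: field_simps)
  next
    case equal
    then show ?thesis using bound S by simp
  next
    case greater
    have "(v - m) / (r - d) \<le> k"
      unfolding k_def
    proof (rule cInf_greatest[OF ne])
      fix y assume "y \<in> Q"
      then obtain r' v' where y: "y = (m - v') / (d - r')" and S': "S r' v'" "r' < d"
        by (auto simp: Q_def)
      \<comment> \<open>The weight that puts the mixture of the two budgets exactly at d, where
        \<open>bound\<close> applies.\<close>
      define t where "t = (d - r') / (r - r')"
      have t': "t * (r - r') = d - r'"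
        using S' greater by (simp add: t_def)
      then have t'': "(1 - t) * (r - r') = r - d" "t * r + (1 - t) * r' = d"
        by (simp_all add: algebra_simps)
      have t: "0 \<le> t" "t \<le> 1"
        using S' greater by (simp_all add: t_def)
      from convex[OF S S'(1) t] t''(2) bound have "t * v + (1 - t) * v' \<le> m" by simp
      then have "t * (v - m) \<le> (1 - t) * (m - v')" by (simp add: algebra_simps)
      then have "(t * (r - r')) * (v - m) \<le> ((1 - t) * (r - r')) * (m - v')"
        using S' greater mult_left_mono[of "t * (v - m)" "(1 - t) * (m - v')" "r - r'"]
        by (simp add: mult_ac)
      then show "(v - m) / (r - d) \<le> y"
        unfolding t' t''(1) y using S' greater by (simp add: field_simps)
    qed
    then show ?thesis using greater by (simp add: field_simps)
  qed
  moreover have "0 \<le> k" unfolding k_def using ne pos by (rule cInf_greatest)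
  ultimately show ?thesis by blast
qed

subsection \<open>Positive definite forms, mixtures and expectations\<close>

lemma spd_matrix_inv:
  assumes "spd M" shows "M *v (matrix_inv M *v b) = b"
proof -
  have "x = 0" if "M *v x = 0" for x
    using assms that unfolding spd_def by (metis inner_zero_right less_irrefl)
  then have "\<exists>B. B ** M = mat 1" by (simp add: matrix_left_invertible_ker)
  then have "invertible M" by (simp add: invertible_left_inverse)
  then have "M ** matrix_inv M = mat 1"
    unfolding invertible_def matrix_inv_def by (rule someI2_ex) simp
  then show ?thesis by (simp add: matrix_vector_mul_assoc)
qed

lemma spd_nonneg: "spd M \<Longrightarrow> 0 \<le> v \<bullet> (M *v v)"
  unfolding spd_def by (cases "v = 0") (auto intro: less_imp_le)

lemma spd_inner_commute: "spd M \<Longrightarrow> v \<bullet> (M *v u) = u \<bullet> (M *v v)"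
  unfolding spd_def by (metis dot_lmul_matrix inner_commute transpose_matrix_vector)

lemma spd_inv_quad:
  "spd M \<Longrightarrow> (matrix_inv M *v b) \<bullet> (M *v (matrix_inv M *v b)) = b \<bullet> (matrix_inv M *v b)"
  by (simp add: spd_matrix_inv inner_commute)

lemma spd_inv_nonneg: "spd M \<Longrightarrow> 0 \<le> b \<bullet> (matrix_inv M *v b)"
  by (metis spd_inv_quad spd_nonneg)

text \<open>The form is nonnegative at \<open>y - t *\<^sub>R (matrix_inv M *v b)\<close>; expanding
  it there gives the inequality, with equality at
  \<open>y = t *\<^sub>R (matrix_inv M *v b)\<close>.\<close>

lemma spd_young:
  assumes "spd M"
  shows "2 * t * (b \<bullet> y) - t\<^sup>2 * (b \<bullet> (matrix_inv M *v b)) \<le> y \<bullet> (M *v y)"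
proof -
  let ?w = "matrix_inv M *v b"
  have "0 \<le> (y - t *\<^sub>R ?w) \<bullet> (M *v (y - t *\<^sub>R ?w))" by (rule spd_nonneg[OF assms])
  also have "\<dots> = y \<bullet> (M *v y) - 2 * t * (b \<bullet> y) + t\<^sup>2 * (b \<bullet> ?w)"
    using spd_inner_commute[OF assms, of ?w y] inner_commute[of y b] inner_commute[of ?w b]
    by (simp add: matrix_vector_mult_diff_distrib matrix_vector_mult_scaleR inner_diff_left
        inner_diff_right spd_matrix_inv[OF assms] right_diff_distrib power2_eq_square)
  finally show ?thesis by simp
qed

text \<open>For \<open>w = matrix_inv M *v b\<close> the eigenvalue bound and Cauchy-Schwarz give
  \<open>r * (norm w)\<^sup>2 \<le> b \<bullet> w \<le> norm b * norm w\<close>. Hence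
  \<open>norm w \<le> norm b / r\<close>, which is inserted into the second inequality.\<close>

lemma spd_inv_eigenvalue_bound:
  assumes M: "spd M" and r: "0 < r" "r \<le> (INF v\<in>{v. norm v = 1}. v \<bullet> (M *v v))"
  shows "b \<bullet> (matrix_inv M *v b) \<le> (norm b)\<^sup>2 / r"
proof (cases "matrix_inv M *v b = 0")
  case True
  then show ?thesis using r by simp
next
  case False
  define w where "w = matrix_inv M *v b"
  define v where "v = (1 / norm w) *\<^sub>R w"
  have w: "norm w > 0" using False by (simp add: w_def)
  have "bdd_below ((\<lambda>v. v \<bullet> (M *v v)) ` {v. norm v = 1})"
    using spd_nonneg[OF M] by (auto intro: bdd_belowI[of _ 0])
  then have "r \<le> v \<bullet> (M *v v)"
    using w by (intro order_trans[OF r(2)] cINF_lower) (auto simp: v_def)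
  also have "\<dots> = (b \<bullet> w) / (norm w)\<^sup>2"
    using spd_inv_quad[OF M, of b] w
    by (simp add: v_def w_def matrix_vector_mult_scaleR power2_eq_square)
  finally have 1: "r * (norm w)\<^sup>2 \<le> b \<bullet> w" using w by (simp add: field_simps)
  have 2: "b \<bullet> w \<le> norm b * norm w" by (rule norm_cauchy_schwarz)
  with 1 have "norm w * (r * norm w) \<le> norm w * norm b"
    by (simp add: power2_eq_square mult_ac)
  then have "norm w \<le> norm b / r" using w r by (simp add: field_simps)
  then have "norm b * norm w \<le> norm b * (norm b / r)" by (rule mult_left_mono) simp
  with 2 show ?thesis by (simp add: w_def power2_eq_square)
qed

text \<open>The dual representation \<open>b \<bullet> M\<^sup>-\<^sup>1 b = sup\<^sub>v (2 b \<bullet> v - v \<bullet> M v)\<close> over a countable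
  dense set of \<open>v\<close> gives measurability without a formula for the inverse.\<close>

lemma measurable_spd_inv_quad:
  fixes A :: "'a \<Rightarrow> real^'n^'n"
  assumes A: "\<And>x. spd (A x)" and meas: "\<And>v. (\<lambda>x. v \<bullet> (A x *v v)) \<in> borel_measurable N"
  shows "(\<lambda>x. b \<bullet> (matrix_inv (A x) *v b)) \<in> borel_measurable N"
proof (rule borel_measurableI_greater)
  fix a
  obtain D :: "(real^'n) set" where D: "countable D" "\<And>X. open X \<Longrightarrow> X \<noteq> {} \<Longrightarrow> \<exists>d\<in>D. d \<in> X"
    by (rule countable_dense_setE) blast
  have "a < b \<bullet> (matrix_inv (A x) *v b) \<longleftrightarrow> (\<exists>v\<in>D. a < 2 * (b \<bullet> v) - v \<bullet> (A x *v v))" for x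
  proof
    let ?w = "matrix_inv (A x) *v b"
    assume less: "a < b \<bullet> ?w"
    let ?X = "{v. a < 2 * (b \<bullet> v) - v \<bullet> (A x *v v)}"
    have "open ?X" by (intro open_Collect_less continuous_intros)
    moreover have "?w \<in> ?X" using less spd_inv_quad[OF A, of x b] by simp
    then have "?X \<noteq> {}" by (metis empty_iff)
    ultimately have "\<exists>d\<in>D. d \<in> ?X" by (rule D(2))
    then show "\<exists>v\<in>D. a < 2 * (b \<bullet> v) - v \<bullet> (A x *v v)" by simp
  next
    assume "\<exists>v\<in>D. a < 2 * (b \<bullet> v) - v \<bullet> (A x *v v)"
    then obtain v where "a < 2 * (b \<bullet> v) - v \<bullet> (A x *v v)" by blast
    with spd_young[OF A, of 1 b v x] show "a < b \<bullet> (matrix_inv (A x) *v b)" by simp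
  qed
  then have "{x \<in> space N. a < b \<bullet> (matrix_inv (A x) *v b)} =
      (\<Union>v\<in>D. {x \<in> space N. a < 2 * (b \<bullet> v) - v \<bullet> (A x *v v)})" by auto
  also have "\<dots> \<in> sets N"
  proof (intro sets.countable_UN'' D(1))
    show "{x \<in> space N. a < 2 * (b \<bullet> v) - v \<bullet> (A x *v v)} \<in> sets N" for v
      by (intro borel_measurable_less borel_measurable_const borel_measurable_diff meas)
  qed
  finally show "{x \<in> space N. a < b \<bullet> (matrix_inv (A x) *v b)} \<in> sets N" .
qed

lemma measurable_spd_inv_mult:
  fixes A :: "'a \<Rightarrow> real^'n^'n"
  assumes A: "\<And>x. spd (A x)" and meas: "\<And>v. (\<lambda>x. v \<bullet> (A x *v v)) \<in> borel_measurable N"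
  shows "(\<lambda>x. matrix_inv (A x) *v b) \<in> borel_measurable N"
proof (rule borel_measurable_euclidean_space[THEN iffD2], rule ballI)
  fix e :: "real^'n"
  \<comment> \<open>Polarisation: the components of the vector come from values of the quadratic
    form, whose measurability is known.\<close>
  have "(matrix_inv (A x) *v b) \<bullet> e = ((b + e) \<bullet> (matrix_inv (A x) *v (b + e))
      - (b - e) \<bullet> (matrix_inv (A x) *v (b - e))) / 4" for x
  proof -
    have "b \<bullet> (matrix_inv (A x) *v e) = e \<bullet> (matrix_inv (A x) *v b)"
      using spd_inner_commute[OF A, of "matrix_inv (A x) *v b" x "matrix_inv (A x) *v e"]
      unfolding spd_matrix_inv[OF A] by (metis inner_commute)
    moreover have "(matrix_inv (A x) *v b) \<bullet> e = e \<bullet> (matrix_inv (A x) *v b)"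
      by (rule inner_commute)
    ultimately show ?thesis
      unfolding matrix_vector_right_distrib matrix_vector_mult_diff_distrib inner_add_left
        inner_add_right inner_diff_left inner_diff_right by simp
  qed
  then show "(\<lambda>x. (matrix_inv (A x) *v b) \<bullet> e) \<in> borel_measurable N"
    by (simp only:) (intro borel_measurable_divide borel_measurable_diff borel_measurable_const
        measurable_spd_inv_quad[OF A meas])
qed

section \<open>Countable mixtures of Borel probability measures\<close>

lemma kernel_in_subprob_algebra:
  fixes K :: "'i \<Rightarrow> 'a::topological_space measure"
  assumes "\<And>i. borel_prob (K i)"
  shows "K \<in> measurable (measure_pmf p) (subprob_algebra borel)"
proof -
  have "K i \<in> space (subprob_algebra borel)" for i
    using assms[of i]
    by (auto simp: borel_prob_def space_subprob_algebra prob_space_imp_subprob_space)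
  then show ?thesis by (auto simp: measurable_def)
qed

lemma borel_prob_bind_pmf:
  fixes K :: "'i \<Rightarrow> 'a::topological_space measure"
  assumes "\<And>i. borel_prob (K i)"
  shows "borel_prob (measure_pmf p \<bind> K)"
  unfolding borel_prob_def
proof
  show "prob_space (measure_pmf p \<bind> K)"
    using assms by (intro measure_pmf.prob_space_bind[OF _ kernel_in_subprob_algebra])
      (auto simp: borel_prob_def)
  show "sets (measure_pmf p \<bind> K) = sets borel"
    using assms by (intro sets_bind) (auto simp: borel_prob_def)
qed

lemma nn_integral_bind_pmf_kernel:
  assumes "\<And>i. borel_prob (K i)" "f \<in> borel_measurable borel"
  shows "(\<integral>\<^sup>+ z. f z \<partial>(measure_pmf p \<bind> K)) = (\<integral>\<^sup>+ i. \<integral>\<^sup>+ z. f z \<partial>K i \<partial>measure_pmf p)"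
  by (rule nn_integral_bind[OF assms(2) kernel_in_subprob_algebra]) (rule assms(1))

text \<open>With f = \<open>fst\<close> this says that a mixture of couplings keeps their common
  first marginal.\<close>

lemma distr_bind_pmf_const:
  fixes f :: "'a::topological_space \<Rightarrow> 'b::topological_space"
  assumes K: "\<And>i. borel_prob (K i)" and f: "f \<in> borel_measurable borel"
    and marg: "\<And>i. distr (K i) borel f = Q" and Q: "borel_prob Q"
  shows "distr (measure_pmf p \<bind> K) borel f = Q"
proof -
  have "distr (measure_pmf p \<bind> K) borel f = (measure_pmf p \<bind> (\<lambda>i. distr (K i) borel f))"
    by (rule distr_bind[OF kernel_in_subprob_algebra[OF K] _ f]) simp
  also have "\<dots> = (measure_pmf p \<bind> (\<lambda>i. Q))" by (simp add: marg)
  also have "\<dots> = Q"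
    using Q by (intro bind_const')
      (auto simp: borel_prob_def prob_space_imp_subprob_space measure_pmf.prob_space_axioms)
  finally show ?thesis .
qed

section \<open>Extended-real expectations\<close>

lemma expect_eq_top: "(\<integral>\<^sup>+ x. e2ennreal (g x) \<partial>P) = \<infinity> \<Longrightarrow> expect P g = \<infinity>"
  by (simp add: expect_def)

lemma expect_eq_topD: "expect P g = \<infinity> \<Longrightarrow> (\<integral>\<^sup>+ x. e2ennreal (g x) \<partial>P) = \<infinity>"
  unfolding expect_def
  by (cases "\<integral>\<^sup>+ x. e2ennreal (g x) \<partial>P"; cases "\<integral>\<^sup>+ x. e2ennreal (- g x) \<partial>P") auto

lemma expect_eq_bot:
  "(\<integral>\<^sup>+ x. e2ennreal (g x) \<partial>P) < \<infinity> \<Longrightarrow> (\<integral>\<^sup>+ x. e2ennreal (- g x) \<partial>P) = \<infinity> \<Longrightarrow> expect P g = -\<infinity>"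
  unfolding expect_def by (cases "\<integral>\<^sup>+ x. e2ennreal (g x) \<partial>P") auto

lemma expect_ge:
  assumes "ennreal a \<le> (\<integral>\<^sup>+ x. e2ennreal (g x) \<partial>P)" "(\<integral>\<^sup>+ x. e2ennreal (- g x) \<partial>P) \<le> ennreal b"
    "0 \<le> a" "0 \<le> b"
  shows "ereal (a - b) \<le> expect P g"
  using assms unfolding expect_def
  by (cases "\<integral>\<^sup>+ x. e2ennreal (g x) \<partial>P"; cases "\<integral>\<^sup>+ x. e2ennreal (- g x) \<partial>P")
    (auto simp: enn2ereal_ennreal top_unique)

text \<open>Negative parts stand on the opposite sides, so that no subtraction of infinite integrals
  occurs. The second premise excludes the case in which both parts of g have infinite integral,
  where the left expectation is \<infinity> by convention while the first premise holds
  trivially.\<close>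

lemma expect_mono_cross:
  assumes "(\<integral>\<^sup>+ x. e2ennreal (g x) \<partial>P) + (\<integral>\<^sup>+ x. e2ennreal (- h x) \<partial>Q)
      \<le> (\<integral>\<^sup>+ x. e2ennreal (h x) \<partial>Q) + (\<integral>\<^sup>+ x. e2ennreal (- g x) \<partial>P)"
    and "(\<integral>\<^sup>+ x. e2ennreal (h x) \<partial>Q) < \<infinity> \<Longrightarrow> (\<integral>\<^sup>+ x. e2ennreal (g x) \<partial>P) < \<infinity>"
  shows "expect P g \<le> expect Q h"
  using assms unfolding expect_def
  by (cases "\<integral>\<^sup>+ x. e2ennreal (g x) \<partial>P"; cases "\<integral>\<^sup>+ x. e2ennreal (- g x) \<partial>P";
      cases "\<integral>\<^sup>+ x. e2ennreal (h x) \<partial>Q"; cases "\<integral>\<^sup>+ x. e2ennreal (- h x) \<partial>Q")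
    (auto simp: enn2ereal_ennreal top_unique ennreal_plus[symmetric] simp del: ennreal_plus)

subsection \<open>Transport along \<open>A(x)\<^sup>-\<^sup>1 \<beta>\<close>\<close>

locale quadratic_transport =
  fixes c :: "real^'n \<Rightarrow> real^'n \<Rightarrow> real"
    and A :: "real^'n \<Rightarrow> real^'n^'n"
    and P\<^sub>0 :: "(real^'n) measure"
    and \<delta> \<rho> :: real
    and \<beta> :: "real^'n"
  assumes delta: "0 < \<delta>"
    and P0: "borel_prob P\<^sub>0"
    and A: "\<And>x. spd (A x)"
    and c: "\<And>x x'. c x x' = (x - x') \<bullet> (A x *v (x - x'))"
    and lsc: "lsc (\<lambda>(x, x'). c x x')"
    and rho: "0 < \<rho>"
    and eigenvalue: "AE x in P\<^sub>0. \<rho> \<le> (INF v\<in>{v. norm v = 1}. v \<bullet> (A x *v v))"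
begin

definition s :: "real^'n \<Rightarrow> real" where
  "s x = \<beta> \<bullet> (matrix_inv (A x) *v \<beta>)"

text \<open>The factor \<open>sqrt \<delta>\<close> makes \<gamma> the variable of \<open>F\<close>:
  the moved point has the argument of \<open>l\<close> in \<open>F\<close> as its inner product with
  \<beta>, and the move costs \<open>\<delta> * \<gamma>\<^sup>2 * s x\<close>.\<close>

definition move :: "real \<Rightarrow> real^'n \<Rightarrow> real^'n" where
  "move \<gamma> x = x + (\<gamma> * sqrt \<delta>) *\<^sub>R (matrix_inv (A x) *v \<beta>)"

sublocale P0: prob_space P\<^sub>0
  using P0 by (simp add: borel_prob_def)

lemma sets_P0[measurable_cong]: "sets P\<^sub>0 = sets borel"
  using P0 by (simp add: borel_prob_def)

lemma c_nonneg: "0 \<le> c x x'"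
  by (simp add: c spd_nonneg[OF A])

lemma c_measurable: "(\<lambda>z. c (fst z) (snd z)) \<in> borel_measurable borel"
  using lsc_borel_measurable[OF lsc] by (simp add: case_prod_unfold)

text \<open>The form at v is the cost of moving x to x - v, so measurability is inherited from the
  lower semicontinuous cost.\<close>

lemma quad_measurable: "(\<lambda>x. v \<bullet> (A x *v v)) \<in> borel_measurable borel"
proof -
  have "(\<lambda>x. (x, x - v)) \<in> borel_measurable borel"
    by (intro borel_measurable_continuous_onI continuous_intros)
  from measurable_compose[OF this c_measurable] show ?thesis by (simp add: c)
qed

lemma s_measurable[measurable]: "s \<in> borel_measurable borel"
  unfolding s_def by (rule measurable_spd_inv_quad[OF A quad_measurable])

lemma inv_measurable[measurable]: "(\<lambda>x. matrix_inv (A x) *v \<beta>) \<in> borel_measurable borel"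
  by (rule measurable_spd_inv_mult[OF A quad_measurable])

lemma move_measurable[measurable (raw)]:
  assumes [measurable]: "g \<in> borel_measurable borel"
  shows "(\<lambda>x. move (g x) x) \<in> borel_measurable borel"
  unfolding move_def by measurable

lemma s_nonneg: "0 \<le> s x"
  by (simp add: s_def spd_inv_nonneg[OF A])

lemma s_bounded: "AE x in P\<^sub>0. s x \<le> (norm \<beta>)\<^sup>2 / \<rho>"
  using eigenvalue by eventually_elim (simp add: s_def spd_inv_eigenvalue_bound[OF A rho])

lemma cost_move: "c x (move \<gamma> x) = \<delta> * \<gamma>\<^sup>2 * s x"
  using delta spd_inv_quad[OF A, of x \<beta>]
  by (simp add: c move_def s_def matrix_vector_mult_scaleR power2_eq_square
      flip: scaleR_minus_left)

lemma inner_move: "\<beta> \<bullet> move \<gamma> x = \<beta> \<bullet> x + \<gamma> * sqrt \<delta> * s x"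
  by (simp add: move_def s_def inner_add_right)

lemma F_eq: "F l A \<delta> \<gamma> \<beta> lam x =
    l (\<beta> \<bullet> x + \<gamma> * sqrt \<delta> * s x) - lam * sqrt \<delta> * (\<gamma>\<^sup>2 * s x - 1)"
  by (simp add: F_def s_def)

text \<open>The point x' is replaced by the point \<open>move \<gamma> x\<close> with the same inner
  product with \<beta>. This leaves the loss unchanged and does not raise the cost.\<close>

lemma penalized_le_F:
  assumes lam: "0 \<le> lam"
  obtains \<gamma> where "l (\<beta> \<bullet> x') + lam * sqrt \<delta> - lam / sqrt \<delta> * c x x' \<le> F l A \<delta> \<gamma> \<beta> lam x"
proof -
  have sd: "sqrt \<delta> * sqrt \<delta> = \<delta>" "0 < sqrt \<delta>" using delta by auto
  define y where "y = x' - x"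
  have c_y: "c x x' = y \<bullet> (A x *v y)"
    using spd_nonneg[OF A, of "-1 *\<^sub>R y" x]
    by (simp add: c y_def matrix_vector_mult_diff_distrib inner_diff_left inner_diff_right)
  define \<gamma> where "\<gamma> = (\<beta> \<bullet> y) / (sqrt \<delta> * s x)"
  \<comment> \<open>If \<open>s x = 0\<close>, the quotient defining \<gamma> is 0 by the convention
    on division by zero. This is the right value, because then \<beta> = 0.\<close>
  have "\<beta> \<bullet> y = 0" if "s x = 0"
  proof -
    have "matrix_inv (A x) *v \<beta> = 0"
      using that A[of x] spd_inv_quad[OF A, of x \<beta>] unfolding spd_def s_def by (metis less_irrefl)
    then have "\<beta> = 0" using spd_matrix_inv[OF A, of x \<beta>] by simp
    then show ?thesis by simp
  qed
  then have 1: "\<gamma> * sqrt \<delta> * s x = \<beta> \<bullet> y"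
    using sd by (cases "s x = 0") (simp_all add: \<gamma>_def)
  \<comment> \<open>The optimal parameter in \<open>spd_young\<close>: by fact \<open>1\<close> the
    linear term is twice the quadratic one, and a single quadratic term remains.\<close>
  have "2 * (\<gamma> * sqrt \<delta>) * (\<beta> \<bullet> y) - (\<gamma> * sqrt \<delta>)\<^sup>2 * s x \<le> c x x'"
    unfolding c_y s_def by (rule spd_young[OF A])
  then have "(\<gamma> * sqrt \<delta>)\<^sup>2 * s x \<le> c x x'"
    unfolding 1[symmetric] by (simp add: power2_eq_square mult_ac del: real_sqrt_mult_self)
  then have "lam / sqrt \<delta> * ((\<gamma> * sqrt \<delta>)\<^sup>2 * s x) \<le> lam / sqrt \<delta> * c x x'"
    using lam sd by (intro mult_left_mono) auto
  moreover have "lam / sqrt \<delta> * ((\<gamma> * sqrt \<delta>)\<^sup>2 * s x) = lam * sqrt \<delta> * (\<gamma>\<^sup>2 * s x)"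
    using sd by (simp add: power2_eq_square field_simps)
  moreover have "\<beta> \<bullet> x + \<gamma> * sqrt \<delta> * s x = \<beta> \<bullet> x'"
    unfolding 1 by (simp add: y_def inner_diff_right)
  ultimately have "l (\<beta> \<bullet> x') + lam * sqrt \<delta> - lam / sqrt \<delta> * c x x' \<le> F l A \<delta> \<gamma> \<beta> lam x"
    by (simp add: F_eq right_diff_distrib)
  then show thesis by (rule that)
qed

section \<open>Measurable maximisers of the penalised loss\<close>

lemma F_measurable:
  assumes "usc l" and [measurable]: "g \<in> borel_measurable borel"
  shows "(\<lambda>x. F l A \<delta> (g x) \<beta> lam x) \<in> borel_measurable borel"
proof -
  note [measurable] = usc_borel_measurable[OF assms(1)]
  show ?thesis unfolding F_eq by measurable
qed

lemma F_argmax: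
  assumes l: "usc l"
  obtains g :: "nat \<Rightarrow> real^'n \<Rightarrow> real" where "\<And>m. g m \<in> borel_measurable borel"
    "\<And>m x. \<bar>g m x\<bar> \<le> real m"
    "\<And>m x t. \<bar>t\<bar> \<le> real m \<Longrightarrow> F l A \<delta> t \<beta> lam x \<le> F l A \<delta> (g m x) \<beta> lam x"
proof -
  \<comment> \<open>\<open>F\<close> depends on x only through \<open>\<beta> \<bullet> x\<close>
    and \<open>s x\<close>. In these variables it is jointly upper semicontinuous, so a Borel
    selection exists there; composing it with the Borel functions of x keeps it Borel.\<close>
  define h :: "real \<times> real \<times> real \<Rightarrow> real" where
    "h = (\<lambda>z. l (fst (snd z) + fst z * sqrt \<delta> * snd (snd z))
      + - (lam * sqrt \<delta> * ((fst z)\<^sup>2 * snd (snd z) - 1)))"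
  have h: "usc h" unfolding h_def
    by (intro usc_add_continuous usc_compose[OF l] continuous_intros)
  have F_h: "F l A \<delta> t \<beta> lam x = h (t, \<beta> \<bullet> x, s x)" for t x
    by (simp add: F_eq h_def)
  have "\<exists>g. g \<in> borel_measurable borel \<and> (\<forall>z. g z \<in> {- real m..real m}) \<and>
      (\<forall>z. \<forall>t\<in>{- real m..real m}. h (t, z) \<le> h (g z, z))" for m :: nat
    by (rule usc_measurable_argmax[OF h, of "- real m" "real m"]) (simp, blast)
  then obtain g where g: "\<And>m. g m \<in> borel_measurable borel"
      "\<And>m z. g m z \<in> {- real m..real m}"
      "\<And>m z t. t \<in> {- real m..real m} \<Longrightarrow> h (t, z) \<le> h (g m z, z)"
    by metis
  show thesis
  proof (rule that[of "\<lambda>m x. g m (\<beta> \<bullet> x, s x)"])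
    fix m
    note g(1)[measurable]
    show "(\<lambda>x. g m (\<beta> \<bullet> x, s x)) \<in> borel_measurable borel"
      by (rule measurable_compose[OF _ g(1)]) (simp add: borel_prod[symmetric])
  next
    fix m x show "\<bar>g m (\<beta> \<bullet> x, s x)\<bar> \<le> real m" using g(2)[of m "(\<beta> \<bullet> x, s x)"] by auto
  next
    fix m x t assume "\<bar>t\<bar> \<le> real m"
    then show "F l A \<delta> t \<beta> lam x \<le> F l A \<delta> (g m (\<beta> \<bullet> x, s x)) \<beta> lam x"
      unfolding F_h by (intro g(3)) auto
  qed
qed

text \<open>Every \<gamma> lies in some interval [-m, m]. The uncountable supremum thus becomes a
  countable one, which gives measurability and later monotone convergence.\<close>

lemma l_rob_SUP_argmax:
  assumes "\<And>m x t. \<bar>t\<bar> \<le> real m \<Longrightarrow> F l A \<delta> t \<beta> lam x \<le> F l A \<delta> (g m x) \<beta> lam x"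
  shows "l_rob l A \<delta> \<beta> lam x = (SUP m. ereal (F l A \<delta> (g m x) \<beta> lam x))"
  unfolding l_rob_def
proof (rule antisym)
  show "(SUP \<gamma>. ereal (F l A \<delta> \<gamma> \<beta> lam x)) \<le> (SUP m. ereal (F l A \<delta> (g m x) \<beta> lam x))"
  proof (rule SUP_mono)
    fix \<gamma> :: real
    obtain m :: nat where "\<bar>\<gamma>\<bar> \<le> real m" using real_arch_simple by blast
    from assms[OF this] show "\<exists>m\<in>UNIV. ereal (F l A \<delta> \<gamma> \<beta> lam x) \<le> ereal (F l A \<delta> (g m x) \<beta> lam x)"
      by auto
  qed
qed (rule SUP_mono, blast)

lemma F_le_l_rob: "ereal (F l A \<delta> \<gamma> \<beta> lam x) \<le> l_rob l A \<delta> \<beta> lam x"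
  unfolding l_rob_def by (rule SUP_upper) simp

lemma l_rob_measurable[measurable]:
  assumes "usc l" shows "l_rob l A \<delta> \<beta> lam \<in> borel_measurable borel"
proof -
  obtain g :: "nat \<Rightarrow> real^'n \<Rightarrow> real" where g: "\<And>m. g m \<in> borel_measurable borel"
    "\<And>m x. \<bar>g m x\<bar> \<le> real m"
    "\<And>m x t. \<bar>t\<bar> \<le> real m \<Longrightarrow> F l A \<delta> t \<beta> lam x \<le> F l A \<delta> (g m x) \<beta> lam x"
    using F_argmax[OF assms] by metis
  have "l_rob l A \<delta> \<beta> lam = (\<lambda>x. SUP m. ereal (F l A \<delta> (g m x) \<beta> lam x))"
    by (rule ext, rule l_rob_SUP_argmax, rule g(3))
  then show ?thesis
    using F_measurable[OF assms g(1)] by (simp add: borel_measurable_SUP)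
qed

text \<open>The pairs (r, v) of a cost budget and a value reached within it. The real bounds a on
  the positive part and b on the negative part keep the value real even if the gain is infinite, and
  make the set of pairs convex.\<close>

definition achieves :: "(real \<Rightarrow> real) \<Rightarrow> real \<Rightarrow> real \<Rightarrow> bool" where
  "achieves l r v \<longleftrightarrow> (\<exists>\<pi> a b. borel_prob \<pi> \<and> distr \<pi> borel fst = P\<^sub>0 \<and> 0 \<le> r \<and> 0 \<le> a \<and> 0 \<le> b \<and>
     (\<integral>\<^sup>+ z. ennreal (c (fst z) (snd z)) \<partial>\<pi>) \<le> ennreal r \<and>
     ennreal a \<le> (\<integral>\<^sup>+ z. ennreal (l (\<beta> \<bullet> snd z)) \<partial>\<pi>) \<and>
     (\<integral>\<^sup>+ z. ennreal (- l (\<beta> \<bullet> snd z)) \<partial>\<pi>) \<le> ennreal b \<and> v \<le> a - b)"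

lemma measurable_fst_snd:
  "(fst :: (real^'n) \<times> (real^'n) \<Rightarrow> _) \<in> borel_measurable borel"
  "(snd :: (real^'n) \<times> (real^'n) \<Rightarrow> _) \<in> borel_measurable borel"
  by (intro borel_measurable_continuous_onI continuous_intros)+

text \<open>The coupling is the law of \<open>(x, move (g x) x)\<close> under
  \<open>P\<^sub>0\<close>; all integrals against it become integrals over
  \<open>P\<^sub>0\<close>.\<close>

lemma achieves_move:
  assumes l: "usc l" and g[measurable]: "g \<in> borel_measurable borel"
    and nonneg: "0 \<le> r" "0 \<le> a" "0 \<le> b"
    and cost: "(\<integral>\<^sup>+ x. ennreal (\<delta> * (g x)\<^sup>2 * s x) \<partial>P\<^sub>0) \<le> ennreal r"
    and pos: "ennreal a \<le> (\<integral>\<^sup>+ x. ennreal (l (\<beta> \<bullet> x + g x * sqrt \<delta> * s x)) \<partial>P\<^sub>0)"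
    and neg: "(\<integral>\<^sup>+ x. ennreal (- l (\<beta> \<bullet> x + g x * sqrt \<delta> * s x)) \<partial>P\<^sub>0) \<le> ennreal b"
  shows "achieves l r (a - b)"
proof -
  note [measurable] = usc_borel_measurable[OF l] c_measurable measurable_fst_snd
  define \<pi> where "\<pi> = distr P\<^sub>0 borel (\<lambda>x. (x, move (g x) x))"
  have m[measurable]: "(\<lambda>x. (x, move (g x) x)) \<in> measurable P\<^sub>0 borel"
    by (simp add: borel_prod[symmetric])
  have "borel_prob \<pi>"
    using P0.prob_space_distr[OF m] by (simp add: \<pi>_def borel_prob_def)
  moreover have "distr \<pi> borel fst = P\<^sub>0"
    unfolding \<pi>_def by (subst distr_distr[OF measurable_fst_snd(1) m]) (simp add: comp_def distr_id2 sets_P0)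
  moreover have "(\<integral>\<^sup>+ z. f z \<partial>\<pi>) = (\<integral>\<^sup>+ x. f (x, move (g x) x) \<partial>P\<^sub>0)"
    if "f \<in> borel_measurable borel" for f :: "_ \<Rightarrow> ennreal"
    unfolding \<pi>_def by (subst nn_integral_distr[OF m]) (use that in simp_all)
  ultimately show ?thesis
    unfolding achieves_def using nonneg cost pos neg
    by (intro exI[of _ \<pi>] exI[of _ a] exI[of _ b]) (simp add: cost_move inner_move)
qed

lemma achieves_mono: "achieves l r v \<Longrightarrow> r \<le> r' \<Longrightarrow> achieves l r' v"
  unfolding achieves_def by (elim exE conjE, intro exI conjI)
    (assumption | erule order_trans, simp add: ennreal_leI)+

lemma snd_marginal_feasible:
  assumes "borel_prob \<pi>" "distr \<pi> borel fst = P\<^sub>0"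
    "(\<integral>\<^sup>+ z. ennreal (c (fst z) (snd z)) \<partial>\<pi>) \<le> ennreal \<delta>"
  shows "expect (distr \<pi> borel snd) (\<lambda>x. ereal (l (\<beta> \<bullet> x))) \<le> worst_case l c P\<^sub>0 \<delta> \<beta>"
proof -
  interpret \<pi>: prob_space \<pi> using assms by (simp add: borel_prob_def)
  have m: "(snd :: (real^'n) \<times> (real^'n) \<Rightarrow> _) \<in> measurable \<pi> borel"
    using assms(1) measurable_fst_snd(2) by (simp add: borel_prob_def cong: measurable_cong_sets)
  have prob: "borel_prob (distr \<pi> borel snd)"
    using \<pi>.prob_space_distr[OF m] by (simp add: borel_prob_def)
  have "transport_cost c P\<^sub>0 (distr \<pi> borel snd) \<le> (\<integral>\<^sup>+ z. ennreal (c (fst z) (snd z)) \<partial>\<pi>)"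
    unfolding transport_cost_def using assms by (intro INF_lower) (simp add: couplings_def)
  also note assms(3)
  finally show ?thesis
    unfolding worst_case_def using prob by (intro SUP_upper) simp
qed

lemma nn_integral_snd_marginal:
  assumes "borel_prob \<pi>" "f \<in> borel_measurable borel"
  shows "(\<integral>\<^sup>+ x. f x \<partial>distr \<pi> borel (snd :: (real^'n) \<times> (real^'n) \<Rightarrow> _)) = (\<integral>\<^sup>+ z. f (snd z) \<partial>\<pi>)"
proof -
  have "(snd :: (real^'n) \<times> (real^'n) \<Rightarrow> _) \<in> measurable \<pi> borel"
    using assms(1) measurable_fst_snd(2) by (simp add: borel_prob_def cong: measurable_cong_sets)
  then show ?thesis using assms(2) by (subst nn_integral_distr) simp_all
qed

lemma achieves_le_worst_case:
  assumes l: "usc l" and "achieves l \<delta> v"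
  shows "ereal v \<le> worst_case l c P\<^sub>0 \<delta> \<beta>"
proof -
  note [measurable] = usc_borel_measurable[OF l]
  from assms(2) obtain \<pi> a b where \<pi>: "borel_prob \<pi>" "distr \<pi> borel fst = P\<^sub>0"
    "(\<integral>\<^sup>+ z. ennreal (c (fst z) (snd z)) \<partial>\<pi>) \<le> ennreal \<delta>"
    and ab: "0 \<le> a" "0 \<le> b" "ennreal a \<le> (\<integral>\<^sup>+ z. ennreal (l (\<beta> \<bullet> snd z)) \<partial>\<pi>)"
    "(\<integral>\<^sup>+ z. ennreal (- l (\<beta> \<bullet> snd z)) \<partial>\<pi>) \<le> ennreal b" "v \<le> a - b"
    unfolding achieves_def by blast
  have "ereal v \<le> ereal (a - b)" using ab by simp
  also have "\<dots> \<le> expect (distr \<pi> borel snd) (\<lambda>x. ereal (l (\<beta> \<bullet> x)))"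
    by (rule expect_ge) (simp_all add: nn_integral_snd_marginal[OF \<pi>(1)] ab)
  also have "\<dots> \<le> worst_case l c P\<^sub>0 \<delta> \<beta>" by (rule snd_marginal_feasible[OF \<pi>])
  finally show ?thesis .
qed

end

subsection \<open>Weak duality\<close>

text \<open>A signed inequality becomes one between nonnegative terms, ready for integration, when
  each negative part is moved to the other side.\<close>

lemma ennreal_balance:
  fixes u v k d :: real
  assumes "u + k \<le> v + d" "0 \<le> k" "0 \<le> d"
  shows "ennreal u + ennreal (- v) + ennreal k \<le> ennreal v + ennreal (- u) + ennreal d"
  using assms by (cases "0 \<le> u"; cases "0 \<le> v")
    (auto simp: ennreal_neg ennreal_plus[symmetric] simp del: ennreal_plus intro!: ennreal_leI)

context quadratic_transport begin

text \<open>A Bernoulli mixture of the two couplings has first marginal \<open>P\<^sub>0\<close>,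
  and cost, gain and loss are the convex combinations.\<close>

lemma achieves_convex:
  assumes l: "usc l" and 1: "achieves l r v" and 2: "achieves l r' v'" and t: "0 \<le> t" "t \<le> 1"
  shows "achieves l (t * r + (1 - t) * r') (t * v + (1 - t) * v')"
proof -
  note [measurable] = usc_borel_measurable[OF l] c_measurable measurable_fst_snd
  obtain \<pi> a b where \<pi>: "borel_prob \<pi>" "distr \<pi> borel fst = P\<^sub>0" "0 \<le> r" "0 \<le> a" "0 \<le> b"
      "(\<integral>\<^sup>+ z. ennreal (c (fst z) (snd z)) \<partial>\<pi>) \<le> ennreal r"
      "ennreal a \<le> (\<integral>\<^sup>+ z. ennreal (l (\<beta> \<bullet> snd z)) \<partial>\<pi>)"
      "(\<integral>\<^sup>+ z. ennreal (- l (\<beta> \<bullet> snd z)) \<partial>\<pi>) \<le> ennreal b" "v \<le> a - b"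
    using 1 unfolding achieves_def by blast
  obtain \<pi>' a' b' where \<pi>': "borel_prob \<pi>'" "distr \<pi>' borel fst = P\<^sub>0" "0 \<le> r'" "0 \<le> a'" "0 \<le> b'"
      "(\<integral>\<^sup>+ z. ennreal (c (fst z) (snd z)) \<partial>\<pi>') \<le> ennreal r'"
      "ennreal a' \<le> (\<integral>\<^sup>+ z. ennreal (l (\<beta> \<bullet> snd z)) \<partial>\<pi>')"
      "(\<integral>\<^sup>+ z. ennreal (- l (\<beta> \<bullet> snd z)) \<partial>\<pi>') \<le> ennreal b'" "v' \<le> a' - b'"
    using 2 unfolding achieves_def by blast
  define K where "K i = (if i then \<pi> else \<pi>')" for i
  have K: "borel_prob (K i)" "distr (K i) borel fst = P\<^sub>0" for i
    using \<pi> \<pi>' by (simp_all add: K_def)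
  define \<mu> where "\<mu> = measure_pmf (bernoulli_pmf t) \<bind> K"
  have int: "(\<integral>\<^sup>+ z. f z \<partial>\<mu>) = ennreal t * (\<integral>\<^sup>+ z. f z \<partial>\<pi>) + ennreal (1 - t) * (\<integral>\<^sup>+ z. f z \<partial>\<pi>')"
    if "f \<in> borel_measurable borel" for f
    unfolding \<mu>_def nn_integral_bind_pmf_kernel[of K, OF K(1) that]
    using t by (simp add: K_def mult.commute)
  have mix: "ennreal t * ennreal x + ennreal (1 - t) * ennreal x' = ennreal (t * x + (1 - t) * x')"
    if "0 \<le> x" "0 \<le> x'" for x x'
    using t that by (simp add: ennreal_mult)
  show ?thesis
    unfolding achieves_def
  proof (rule exI[of _ \<mu>], rule exI[of _ "t * a + (1 - t) * a'"],
      rule exI[of _ "t * b + (1 - t) * b'"], intro conjI)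
    show "borel_prob \<mu>" unfolding \<mu>_def by (rule borel_prob_bind_pmf) (rule K)
    show "distr \<mu> borel fst = P\<^sub>0"
      unfolding \<mu>_def by (rule distr_bind_pmf_const[OF K(1) measurable_fst_snd(1) K(2) P0])
    show "(\<integral>\<^sup>+ z. ennreal (c (fst z) (snd z)) \<partial>\<mu>) \<le> ennreal (t * r + (1 - t) * r')"
      using \<pi> \<pi>' by (subst int) (measurable, simp only: mix[symmetric], intro add_mono mult_left_mono, auto)
    show "ennreal (t * a + (1 - t) * a') \<le> (\<integral>\<^sup>+ z. ennreal (l (\<beta> \<bullet> snd z)) \<partial>\<mu>)"
      using \<pi> \<pi>' by (subst int) (measurable, simp only: mix[symmetric], intro add_mono mult_left_mono, auto)
    show "(\<integral>\<^sup>+ z. ennreal (- l (\<beta> \<bullet> snd z)) \<partial>\<mu>) \<le> ennreal (t * b + (1 - t) * b')"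
      using \<pi> \<pi>' by (subst int) (measurable, simp only: mix[symmetric], intro add_mono mult_left_mono, auto)
    have "t * v + (1 - t) * v' \<le> t * (a - b) + (1 - t) * (a' - b')"
      using t \<pi> \<pi>' by (intro add_mono mult_left_mono) auto
    then show "t * v + (1 - t) * v' \<le> t * a + (1 - t) * a' - (t * b + (1 - t) * b')"
      by (simp add: algebra_simps)
  qed (use t \<pi> \<pi>' in auto)
qed

lemma penalized_le_l_rob:
  assumes "0 \<le> lam"
  shows "ereal (l (\<beta> \<bullet> x') + lam * sqrt \<delta> - lam / sqrt \<delta> * c x x') \<le> l_rob l A \<delta> \<beta> lam x"
  using penalized_le_F[OF assms, of l x' x] F_le_l_rob[of l _ lam x] by (meson ereal_less_eq(3) order_trans)

lemma weak_duality_pointwise: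
  assumes "0 \<le> lam"
  shows "ennreal (l (\<beta> \<bullet> x')) + e2ennreal (- l_rob l A \<delta> \<beta> lam x) + ennreal (lam * sqrt \<delta>)
    \<le> e2ennreal (l_rob l A \<delta> \<beta> lam x) + ennreal (- l (\<beta> \<bullet> x')) + ennreal (lam / sqrt \<delta>) * ennreal (c x x')"
proof (cases "l_rob l A \<delta> \<beta> lam x")
  case (real y)
  have "l (\<beta> \<bullet> x') + lam * sqrt \<delta> \<le> y + lam / sqrt \<delta> * c x x'"
    using penalized_le_l_rob[OF assms, of l x' x] unfolding real by simp
  from ennreal_balance[OF this] show ?thesis
    using assms delta c_nonneg[of x x'] unfolding real
    by (simp add: ennreal_mult[symmetric] del: times_divide_eq_left)
next
  case MInf
  then show ?thesis using F_le_l_rob[of l 0 lam x] by simp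
qed simp

text \<open>A bound without negative parts; integrated over a coupling of finite cost, it provides
  the second premise of \<open>expect_mono_cross\<close>.\<close>

lemma pos_part_le_l_rob:
  assumes "0 \<le> lam"
  shows "ennreal (l (\<beta> \<bullet> x')) \<le> e2ennreal (l_rob l A \<delta> \<beta> lam x) + ennreal (lam / sqrt \<delta>) * ennreal (c x x')"
proof (cases "l_rob l A \<delta> \<beta> lam x")
  case (real y)
  have "l (\<beta> \<bullet> x') + lam * sqrt \<delta> \<le> y + lam / sqrt \<delta> * c x x'"
    using penalized_le_l_rob[OF assms, of l x' x] unfolding real by simp
  moreover have "0 \<le> lam * sqrt \<delta>" "0 \<le> lam / sqrt \<delta> * c x x'"
    using assms delta c_nonneg[of x x'] by auto
  ultimately have "ennreal (l (\<beta> \<bullet> x')) \<le> ennreal (max 0 y + lam / sqrt \<delta> * c x x')"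
    by (intro ennreal_leI) auto
  also have "\<dots> = ennreal y + ennreal (lam / sqrt \<delta> * c x x')"
    using \<open>0 \<le> lam / sqrt \<delta> * c x x'\<close> by (simp add: ennreal_plus)
  finally show ?thesis
    using assms delta c_nonneg[of x x'] unfolding real
    by (simp add: ennreal_mult[symmetric] del: times_divide_eq_left)
next
  case MInf
  then show ?thesis using F_le_l_rob[of l 0 lam x] by simp
qed simp

lemma weak_duality:
  assumes l: "usc l" and lam: "0 \<le> lam"
  shows "worst_case l c P\<^sub>0 \<delta> \<beta> \<le> f_dual l A P\<^sub>0 \<delta> \<beta> lam"
  unfolding worst_case_def f_dual_def
proof (rule SUP_least)
  note [measurable] = usc_borel_measurable[OF l] c_measurable l_rob_measurable[OF l] measurable_fst_snd
  fix P assume "P \<in> {P. borel_prob P \<and> transport_cost c P\<^sub>0 P \<le> ennreal \<delta>}"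
  then have cost: "transport_cost c P\<^sub>0 P \<le> ennreal \<delta>" by simp
  let ?R = "l_rob l A \<delta> \<beta> lam"
  define k where "k = lam / sqrt \<delta>"
  have k: "0 \<le> k" "lam * sqrt \<delta> = k * \<delta>" using lam delta by (auto simp: k_def field_simps)
  \<comment> \<open>The transport cost is an infimum, so a coupling is available only at a cost
    slightly above \<delta>.\<close>
  have near: "\<exists>\<pi>. borel_prob \<pi> \<and> distr \<pi> borel fst = P\<^sub>0 \<and> distr \<pi> borel snd = P \<and>
      (\<integral>\<^sup>+ z. ennreal (c (fst z) (snd z)) \<partial>\<pi>) \<le> ennreal (\<delta> + e)" if "0 < e" for e
  proof -
    have "ennreal \<delta> < ennreal (\<delta> + e)" using that delta by (simp add: ennreal_less_iff)
    with cost have "transport_cost c P\<^sub>0 P < ennreal (\<delta> + e)" by (rule le_less_trans)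
    then show ?thesis
      unfolding transport_cost_def INF_less_iff couplings_def by (auto intro: less_imp_le)
  qed
  have marg: "(\<integral>\<^sup>+ z. f (fst z) \<partial>\<pi>) = (\<integral>\<^sup>+ x. f x \<partial>P\<^sub>0)" "(\<integral>\<^sup>+ z. f (snd z) \<partial>\<pi>) = (\<integral>\<^sup>+ x. f x \<partial>P)"
    if \<pi>: "borel_prob \<pi>" "distr \<pi> borel fst = P\<^sub>0" "distr \<pi> borel snd = P"
      and f: "f \<in> borel_measurable borel" for \<pi> and f :: "real^'n \<Rightarrow> ennreal"
  proof -
    have "fst \<in> measurable \<pi> borel" "snd \<in> measurable \<pi> borel"
      using \<pi>(1) measurable_fst_snd by (simp_all add: borel_prob_def cong: measurable_cong_sets)
    then show "(\<integral>\<^sup>+ z. f (fst z) \<partial>\<pi>) = (\<integral>\<^sup>+ x. f x \<partial>P\<^sub>0)" "(\<integral>\<^sup>+ z. f (snd z) \<partial>\<pi>) = (\<integral>\<^sup>+ x. f x \<partial>P)"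
      using f by (simp_all add: \<pi>(2,3)[symmetric] nn_integral_distr)
  qed
  let ?lp = "\<integral>\<^sup>+ x. ennreal (l (\<beta> \<bullet> x)) \<partial>P" and ?ln = "\<integral>\<^sup>+ x. ennreal (- l (\<beta> \<bullet> x)) \<partial>P"
  let ?rp = "\<integral>\<^sup>+ x. e2ennreal (?R x) \<partial>P\<^sub>0" and ?rn = "\<integral>\<^sup>+ x. e2ennreal (- ?R x) \<partial>P\<^sub>0"
  show "expect P (\<lambda>x. ereal (l (\<beta> \<bullet> x))) \<le> expect P\<^sub>0 ?R"
  proof (rule expect_mono_cross, unfold uminus_ereal.simps e2ennreal_ereal)
    \<comment> \<open>The finite term \<open>k * \<delta>\<close>, which is
      \<open>lam * sqrt \<delta>\<close>, is carried on both sides and cancelled at the end. It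
      absorbs the cost of the coupling up to e.\<close>
    have "ennreal (k * \<delta>) + (?lp + ?rn) \<le> ennreal (k * \<delta>) + (?rp + ?ln)"
    proof (rule ennreal_le_epsilon)
      fix e :: real assume e: "0 < e"
      \<comment> \<open>The denominator k + 1 ensures \<open>k * e' \<le> e\<close> and also covers
        k = 0.\<close>
      define e' where "e' = e / (k + 1)"
      have e': "0 < e'" "k * e' \<le> e" using e k by (auto simp: e'_def field_simps)
      obtain \<pi> where \<pi>: "borel_prob \<pi>" "distr \<pi> borel fst = P\<^sub>0" "distr \<pi> borel snd = P"
        "(\<integral>\<^sup>+ z. ennreal (c (fst z) (snd z)) \<partial>\<pi>) \<le> ennreal (\<delta> + e')" using near[OF e'(1)] by blast
      interpret \<pi>: prob_space \<pi> using \<pi>(1) by (simp add: borel_prob_def)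
      have [measurable_cong]: "sets \<pi> = sets borel" using \<pi>(1) by (simp add: borel_prob_def)
      have "ennreal (k * \<delta>) + (?lp + ?rn) = (\<integral>\<^sup>+ z. ennreal (l (\<beta> \<bullet> snd z)) + e2ennreal (- ?R (fst z)) + ennreal (lam * sqrt \<delta>) \<partial>\<pi>)"
        using marg[OF \<pi>(1-3), symmetric, of "\<lambda>x. ennreal (l (\<beta> \<bullet> x))"] marg[OF \<pi>(1-3), symmetric, of "\<lambda>x. e2ennreal (- ?R x)"]
        by (simp add: nn_integral_add k \<pi>.emeasure_space_1 ac_simps)
      also have "\<dots> \<le> (\<integral>\<^sup>+ z. e2ennreal (?R (fst z)) + ennreal (- l (\<beta> \<bullet> snd z)) + ennreal k * ennreal (c (fst z) (snd z)) \<partial>\<pi>)"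
        unfolding k_def by (intro nn_integral_mono weak_duality_pointwise[OF lam])
      also have "\<dots> = ?rp + ?ln + ennreal k * (\<integral>\<^sup>+ z. ennreal (c (fst z) (snd z)) \<partial>\<pi>)"
        using marg[OF \<pi>(1-3), of "\<lambda>x. ennreal (- l (\<beta> \<bullet> x))"] marg[OF \<pi>(1-3), of "\<lambda>x. e2ennreal (?R x)"]
        by (simp add: nn_integral_add nn_integral_cmult)
      also have "\<dots> \<le> ?rp + ?ln + ennreal k * ennreal (\<delta> + e')"
        by (intro add_mono mult_left_mono \<pi>(4)) auto
      also have "\<dots> \<le> ?rp + ?ln + ennreal (k * \<delta> + e)"
      proof (intro add_mono order_refl)
        have "ennreal k * ennreal (\<delta> + e') = ennreal (k * (\<delta> + e'))"
          using k delta e' by (simp only: ennreal_mult[symmetric] add_nonneg_nonneg less_imp_le)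
        also have "\<dots> \<le> ennreal (k * \<delta> + e)"
          using e' by (intro ennreal_leI) (simp add: distrib_left)
        finally show "ennreal k * ennreal (\<delta> + e') \<le> ennreal (k * \<delta> + e)" .
      qed
      also have "\<dots> = ennreal (k * \<delta>) + (?rp + ?ln) + ennreal e"
        using k delta e by (simp add: ac_simps)
      finally show "ennreal (k * \<delta>) + (?lp + ?rn) \<le> ennreal (k * \<delta>) + (?rp + ?ln) + ennreal e" .
    qed
    then show "?lp + ?rn \<le> ?rp + ?ln" by (simp add: ennreal_add_left_cancel_le)
  next
    assume fin: "?rp < \<infinity>"
    obtain \<pi> where \<pi>: "borel_prob \<pi>" "distr \<pi> borel fst = P\<^sub>0" "distr \<pi> borel snd = P"
      "(\<integral>\<^sup>+ z. ennreal (c (fst z) (snd z)) \<partial>\<pi>) \<le> ennreal (\<delta> + 1)" using near[of 1] by auto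
    have [measurable_cong]: "sets \<pi> = sets borel" using \<pi>(1) by (simp add: borel_prob_def)
    have "?lp = (\<integral>\<^sup>+ z. ennreal (l (\<beta> \<bullet> snd z)) \<partial>\<pi>)"
      by (rule marg(2)[OF \<pi>(1-3), symmetric]) measurable
    also have "\<dots> \<le> (\<integral>\<^sup>+ z. e2ennreal (?R (fst z)) + ennreal k * ennreal (c (fst z) (snd z)) \<partial>\<pi>)"
      unfolding k_def by (intro nn_integral_mono pos_part_le_l_rob[OF lam])
    also have "\<dots> = ?rp + ennreal k * (\<integral>\<^sup>+ z. ennreal (c (fst z) (snd z)) \<partial>\<pi>)"
      using marg(1)[OF \<pi>(1-3), of "\<lambda>x. e2ennreal (?R x)"]
      by (simp add: nn_integral_add nn_integral_cmult)
    also have "\<dots> \<le> ?rp + ennreal k * ennreal (\<delta> + 1)"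
      by (intro add_mono mult_left_mono \<pi>(4)) auto
    also have "\<dots> < \<infinity>" using fin by (simp add: ennreal_mult_less_top)
    finally show "?lp < \<infinity>" .
  qed
qed

end

subsection \<open>Strong duality\<close>

lemma e2ennreal_SUP:
  fixes f :: "nat \<Rightarrow> ereal"
  assumes "incseq f" shows "e2ennreal (SUP i. f i) = (SUP i. e2ennreal (f i))"
  using sup_continuousD[OF sup_continuous_e2ennreal[OF sup_continuous_id] assms] by simp

text \<open>Testing X against the reals below it yields finiteness along with the bound.\<close>

lemma ennreal_le_of_reals:
  assumes "\<And>y. 0 \<le> y \<Longrightarrow> ennreal y \<le> X \<Longrightarrow> y \<le> z"
  shows "X \<le> ennreal z"
proof (cases X)
  case (real r)
  then show ?thesis using assms[of r] by (simp add: ennreal_leI)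
next
  case top
  then show ?thesis using assms[of "max 0 z + 1"] by simp
qed

context quadratic_transport begin

text \<open>Strong duality, given one plan \<open>g\<^sub>0\<close> of cost below \<open>\<delta>\<close> whose loss has integrable negative
  part. The multiplier is a supergradient at \<open>\<delta>\<close> of the value as a function of the budget; the dual
  objective at it is approached by the plans that follow the maximiser of \<open>F\<close> over
  \<open>\<bar>\<gamma>\<bar> \<le> m\<close> where this beats \<open>g\<^sub>0\<close>, and \<open>g\<^sub>0\<close> elsewhere.\<close>

lemma dual_le_achievable_bound:
  assumes l: "usc l" and g0[measurable]: "g\<^sub>0 \<in> borel_measurable borel"
    and cost0: "(\<integral>\<^sup>+ x. ennreal (\<delta> * (g\<^sub>0 x)\<^sup>2 * s x) \<partial>P\<^sub>0) < ennreal \<delta>"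
    and neg0: "(\<integral>\<^sup>+ x. ennreal (- l (\<beta> \<bullet> x + g\<^sub>0 x * sqrt \<delta> * s x)) \<partial>P\<^sub>0) < \<infinity>"
    and bound: "\<And>v. achieves l \<delta> v \<Longrightarrow> v \<le> M"
  obtains lam where "0 \<le> lam" "f_dual l A P\<^sub>0 \<delta> \<beta> lam \<le> ereal M"
proof -
  note [measurable] = usc_borel_measurable[OF l] l_rob_measurable[OF l]
  have cost_nonneg: "0 \<le> \<delta> * t\<^sup>2 * s x" for t x using delta s_nonneg[of x] by simp
  define C0 where "C0 = enn2real (\<integral>\<^sup>+ x. ennreal (\<delta> * (g\<^sub>0 x)\<^sup>2 * s x) \<partial>P\<^sub>0)"
  define N0 where "N0 = enn2real (\<integral>\<^sup>+ x. ennreal (- l (\<beta> \<bullet> x + g\<^sub>0 x * sqrt \<delta> * s x)) \<partial>P\<^sub>0)"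
  have C0: "(\<integral>\<^sup>+ x. ennreal (\<delta> * (g\<^sub>0 x)\<^sup>2 * s x) \<partial>P\<^sub>0) = ennreal C0" "0 \<le> C0"
  proof -
    have "(\<integral>\<^sup>+ x. ennreal (\<delta> * (g\<^sub>0 x)\<^sup>2 * s x) \<partial>P\<^sub>0) < \<top>"
      using cost0 ennreal_less_top by (rule order.strict_trans)
    then show "(\<integral>\<^sup>+ x. ennreal (\<delta> * (g\<^sub>0 x)\<^sup>2 * s x) \<partial>P\<^sub>0) = ennreal C0"
      unfolding C0_def by (rule ennreal_enn2real[symmetric])
    show "0 \<le> C0" by (simp add: C0_def)
  qed
  have N0: "(\<integral>\<^sup>+ x. ennreal (- l (\<beta> \<bullet> x + g\<^sub>0 x * sqrt \<delta> * s x)) \<partial>P\<^sub>0) = ennreal N0" "0 \<le> N0"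
    using neg0 by (simp_all add: N0_def)
  have less: "C0 < \<delta>" using cost0 C0 by (simp add: ennreal_less_iff)
  \<comment> \<open>The point at a budget strictly below \<delta>, from which the supergradient gets
    a finite slope.\<close>
  have base: "achieves l C0 (0 - N0)"
    by (rule achieves_move[OF l g0]) (simp_all add: C0 N0)
  have "\<exists>k\<ge>0. \<forall>r v. achieves l r v \<longrightarrow> v \<le> M + k * (r - \<delta>)"
  proof (rule concave_supergradient[where S = "achieves l", OF _ _ base less])
    show "achieves l (t * r + (1 - t) * r') (t * v + (1 - t) * v')"
      if "achieves l r v" "achieves l r' v'" "0 \<le> t" "t \<le> 1" for r v r' v' t
      using that by (rule achieves_convex[OF l])
    show "achieves l r' v" if "achieves l r v" "r \<le> r'" for r r' v
      using that by (rule achieves_mono)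
    show "v \<le> M" if "achieves l \<delta> v" for v
      using that by (rule bound)
  qed
  then obtain k where k: "0 \<le> k" "\<And>r v. achieves l r v \<Longrightarrow> v \<le> M + k * (r - \<delta>)"
    by blast
  define lam where "lam = k * sqrt \<delta>"
  have lam: "0 \<le> lam" "lam * sqrt \<delta> = k * \<delta>" using k delta by (auto simp: lam_def)
  have F_k: "F l A \<delta> \<gamma> \<beta> lam x = l (\<beta> \<bullet> x + \<gamma> * sqrt \<delta> * s x) - k * (\<delta> * \<gamma>\<^sup>2 * s x) + k * \<delta>" for \<gamma> x
    unfolding F_eq lam by (simp add: algebra_simps)
  obtain g :: "nat \<Rightarrow> real^'n \<Rightarrow> real" where g[measurable]: "\<And>m. g m \<in> borel_measurable borel"
    and g_le: "\<And>m x. \<bar>g m x\<bar> \<le> real m"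
    and g_max: "\<And>m x t. \<bar>t\<bar> \<le> real m \<Longrightarrow> F l A \<delta> t \<beta> lam x \<le> F l A \<delta> (g m x) \<beta> lam x"
    by (rule F_argmax[OF l, of lam]) blast
  define F0 where "F0 x = F l A \<delta> (g\<^sub>0 x) \<beta> lam x" for x
  define \<gamma> where "\<gamma> m x = (if F0 x \<le> F l A \<delta> (g m x) \<beta> lam x then g m x else g\<^sub>0 x)" for m x
  define G where "G m x = F l A \<delta> (\<gamma> m x) \<beta> lam x" for m x
  have G_max: "G m x = max (F l A \<delta> (g m x) \<beta> lam x) (F0 x)" for m x
    by (simp add: G_def \<gamma>_def F0_def max_def)
  have F0_m[measurable]: "F0 \<in> borel_measurable borel"
    unfolding F0_def by (rule F_measurable[OF l g0])
  have [measurable]: "(\<lambda>x. F l A \<delta> (g m x) \<beta> lam x) \<in> borel_measurable borel" for m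
    by (rule F_measurable[OF l g])
  have \<gamma>_m[measurable]: "\<gamma> m \<in> borel_measurable borel" for m
    unfolding \<gamma>_def by measurable
  have G_m[measurable]: "G m \<in> borel_measurable borel" for m
    unfolding G_def by (rule F_measurable[OF l \<gamma>_m])
  \<comment> \<open>Since \<open>G m\<close> is at least \<open>F0\<close>, this one integrable
    function dominates the negative parts of all \<open>G m\<close> and of
    \<open>l_rob\<close>.\<close>
  define h where "h x = max 0 (- F0 x)" for x
  have h_m[measurable]: "h \<in> borel_measurable borel" unfolding h_def by measurable
  have h: "0 \<le> h x" "0 \<le> G m x + h x" for m x by (auto simp: h_def G_max)
  define H where "H = enn2real (\<integral>\<^sup>+ x. ennreal (h x) \<partial>P\<^sub>0)"
  have "(\<integral>\<^sup>+ x. ennreal (h x) \<partial>P\<^sub>0) < \<infinity>"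
  proof -
    have "ennreal (h x) \<le> ennreal (- l (\<beta> \<bullet> x + g\<^sub>0 x * sqrt \<delta> * s x)) + ennreal k * ennreal (\<delta> * (g\<^sub>0 x)\<^sup>2 * s x)" for x
    proof -
      let ?u = "l (\<beta> \<bullet> x + g\<^sub>0 x * sqrt \<delta> * s x)" and ?d = "\<delta> * (g\<^sub>0 x)\<^sup>2 * s x"
      have "0 \<le> k * ?d" "0 \<le> k * \<delta>" using k delta cost_nonneg by auto
      then have "ennreal (h x) \<le> ennreal (max 0 (- ?u) + k * ?d)"
        unfolding h_def F0_def F_k by (intro ennreal_leI) auto
      also have "\<dots> = ennreal (- ?u) + ennreal k * ennreal ?d"
        using \<open>0 \<le> k * ?d\<close> k cost_nonneg by (subst ennreal_plus) (simp_all only: ennreal_mult, simp_all)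
      finally show ?thesis .
    qed
    then have "(\<integral>\<^sup>+ x. ennreal (h x) \<partial>P\<^sub>0) \<le> (\<integral>\<^sup>+ x. ennreal (- l (\<beta> \<bullet> x + g\<^sub>0 x * sqrt \<delta> * s x)) + ennreal k * ennreal (\<delta> * (g\<^sub>0 x)\<^sup>2 * s x) \<partial>P\<^sub>0)"
      by (rule nn_integral_mono)
    also have "\<dots> = ennreal N0 + ennreal k * ennreal C0"
      unfolding N0(1)[symmetric] C0(1)[symmetric] by (simp add: nn_integral_add nn_integral_cmult)
    also have "\<dots> < \<infinity>" by (simp add: ennreal_mult_less_top)
    finally show ?thesis .
  qed
  then have H: "(\<integral>\<^sup>+ x. ennreal (h x) \<partial>P\<^sub>0) = ennreal H" "0 \<le> H"
    by (simp_all add: H_def)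
  \<comment> \<open>The plan \<open>\<gamma> m\<close> achieves a value at its cost C, and the
    supergradient bounds this value by \<open>M + k * (C - \<delta>)\<close>. In terms of
    \<open>G m\<close>, in which the cost is already penalised by k, this is a bound free of C and
    m.\<close>
  have key: "y \<le> M + H" if y: "0 \<le> y" "ennreal y \<le> (\<integral>\<^sup>+ x. ennreal (G m x + h x) \<partial>P\<^sub>0)" for m y
  proof -
    let ?C = "\<integral>\<^sup>+ x. ennreal (\<delta> * (\<gamma> m x)\<^sup>2 * s x) \<partial>P\<^sub>0"
    let ?u = "\<lambda>x. l (\<beta> \<bullet> x + \<gamma> m x * sqrt \<delta> * s x)"
    let ?X = "\<integral>\<^sup>+ x. ennreal (G m x + h x) \<partial>P\<^sub>0"
    \<comment> \<open>The cost is finite since \<open>g m\<close> is bounded by m and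
      \<open>s\<close> is essentially bounded by the eigenvalue condition.\<close>
    have "?C \<le> (\<integral>\<^sup>+ x. ennreal (\<delta> * (real m)\<^sup>2 * ((norm \<beta>)\<^sup>2 / \<rho>)) + ennreal (\<delta> * (g\<^sub>0 x)\<^sup>2 * s x) \<partial>P\<^sub>0)"
    proof (rule nn_integral_mono_AE, use s_bounded in eventually_elim)
      fix x assume sx: "s x \<le> (norm \<beta>)\<^sup>2 / \<rho>"
      have "\<bar>g m x\<bar>\<^sup>2 \<le> (real m)\<^sup>2" by (intro power_mono g_le) simp
      then have "\<delta> * (g m x)\<^sup>2 * s x \<le> \<delta> * (real m)\<^sup>2 * ((norm \<beta>)\<^sup>2 / \<rho>)"
        using delta s_nonneg[of x] sx by (intro mult_mono) auto
      then have "ennreal (\<delta> * (g m x)\<^sup>2 * s x) \<le> ennreal (\<delta> * (real m)\<^sup>2 * ((norm \<beta>)\<^sup>2 / \<rho>))"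
        by (rule ennreal_leI)
      then show "ennreal (\<delta> * (\<gamma> m x)\<^sup>2 * s x) \<le>
          ennreal (\<delta> * (real m)\<^sup>2 * ((norm \<beta>)\<^sup>2 / \<rho>)) + ennreal (\<delta> * (g\<^sub>0 x)\<^sup>2 * s x)"
        by (auto simp: \<gamma>_def intro: add_increasing add_increasing2)
    qed
    also have "\<dots> = ennreal (\<delta> * (real m)\<^sup>2 * ((norm \<beta>)\<^sup>2 / \<rho>)) + ennreal C0"
      unfolding C0(1)[symmetric] by (simp add: nn_integral_add P0.emeasure_space_1)
    also have "\<dots> < \<infinity>" by simp
    finally obtain C where C: "?C = ennreal C" "0 \<le> C" by (cases ?C) auto
    have F_u: "G m x = ?u x - k * (\<delta> * (\<gamma> m x)\<^sup>2 * s x) + k * \<delta>" for x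
      by (simp add: G_def F_k)
    have "(\<integral>\<^sup>+ x. ennreal (- ?u x) \<partial>P\<^sub>0) \<le> (\<integral>\<^sup>+ x. ennreal (h x) + ennreal (k * \<delta>) \<partial>P\<^sub>0)"
    proof (rule nn_integral_mono)
      fix x
      have "0 \<le> k * (\<delta> * (\<gamma> m x)\<^sup>2 * s x)" using k(1) cost_nonneg by (rule mult_nonneg_nonneg)
      then have "- ?u x \<le> h x + k * \<delta>" using h(2)[of m x] F_u[of x] by linarith
      then have "ennreal (- ?u x) \<le> ennreal (h x + k * \<delta>)" by (rule ennreal_leI)
      then show "ennreal (- ?u x) \<le> ennreal (h x) + ennreal (k * \<delta>)"
        using h k delta by (simp add: ennreal_plus)
    qed
    also have "\<dots> = ennreal H + ennreal (k * \<delta>)"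
      unfolding H(1)[symmetric] by (simp add: nn_integral_add P0.emeasure_space_1)
    also have "\<dots> < \<infinity>" by simp
    finally obtain N where N: "(\<integral>\<^sup>+ x. ennreal (- ?u x) \<partial>P\<^sub>0) = ennreal N" "0 \<le> N"
      by (cases "\<integral>\<^sup>+ x. ennreal (- ?u x) \<partial>P\<^sub>0") auto
    have "ennreal (G m x + h x) + ennreal (- ?u x) + ennreal k * ennreal (\<delta> * (\<gamma> m x)\<^sup>2 * s x)
        = ennreal (?u x) + ennreal (k * \<delta>) + ennreal (h x)" for x
    proof -
      have "0 \<le> k * (\<delta> * (\<gamma> m x)\<^sup>2 * s x)" "0 \<le> k * \<delta>" using k delta cost_nonneg by auto
      then show ?thesis
        using h(1)[of x] h(2)[of m x] F_u[of x] k(1) cost_nonneg[of "\<gamma> m x" x]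
        by (cases "0 \<le> ?u x")
          (simp_all only: ennreal_mult[symmetric] ennreal_plus[symmetric] ennreal_neg neg_le_0_iff_le
            add_nonneg_nonneg not_le less_imp_le,
           simp_all add: ennreal_neg ennreal_plus[symmetric] del: ennreal_plus)
    qed
    then have "(\<integral>\<^sup>+ x. ennreal (G m x + h x) + ennreal (- ?u x) + ennreal k * ennreal (\<delta> * (\<gamma> m x)\<^sup>2 * s x) \<partial>P\<^sub>0)
        = (\<integral>\<^sup>+ x. ennreal (?u x) + ennreal (k * \<delta>) + ennreal (h x) \<partial>P\<^sub>0)" by simp
    then have eq: "?X + ennreal N + ennreal k * ennreal C = (\<integral>\<^sup>+ x. ennreal (?u x) \<partial>P\<^sub>0) + ennreal (k * \<delta>) + ennreal H"
      unfolding C(1)[symmetric] N(1)[symmetric] H(1)[symmetric]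
      by (simp add: nn_integral_add nn_integral_cmult P0.emeasure_space_1)
    \<comment> \<open>Obtained by solving \<open>eq\<close> for the gain, with the real y in place
      of \<open>?X\<close>. The maximum with 0 meets the sign condition in \<open>achieves\<close>
      and only strengthens the conclusion.\<close>
    define a where "a = max 0 (y + N + k * C - k * \<delta> - H)"
    have "ennreal a \<le> (\<integral>\<^sup>+ x. ennreal (?u x) \<partial>P\<^sub>0)"
    proof (cases "\<integral>\<^sup>+ x. ennreal (?u x) \<partial>P\<^sub>0")
      case (real r)
      have "ennreal (y + N + k * C) = ennreal y + ennreal N + ennreal k * ennreal C"
        using y N C k by (simp add: ennreal_mult)
      also have "\<dots> \<le> ?X + ennreal N + ennreal k * ennreal C" by (intro add_mono y order_refl)
      also have "\<dots> = ennreal (r + k * \<delta> + H)" using eq real k delta H by simp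
      finally have "ennreal (y + N + k * C) \<le> ennreal (r + k * \<delta> + H)" .
      moreover have "0 \<le> r + k * \<delta> + H" using real k(1) delta H(2) by simp
      ultimately have "y + N + k * C \<le> r + k * \<delta> + H" by (simp only: ennreal_le_iff)
      then show ?thesis unfolding real a_def using real by (intro ennreal_leI) auto
    qed simp
    then have "achieves l C (a - N)"
      using C N by (intro achieves_move[OF l \<gamma>_m[of m]]) (simp_all add: a_def)
    from k(2)[OF this] show ?thesis by (simp add: a_def algebra_simps)
  qed
  have X_le: "(\<integral>\<^sup>+ x. ennreal (G m x + h x) \<partial>P\<^sub>0) \<le> ennreal (M + H)" for m
    by (rule ennreal_le_of_reals) (rule key)
  have MH: "0 \<le> M + H" by (rule key[of 0 0]) simp_all
  have inc: "incseq (\<lambda>m. G m x)" for x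
  proof (rule incseq_SucI)
    fix m
    have "\<bar>g m x\<bar> \<le> real (Suc m)" using g_le[of m x] by simp
    from g_max[OF this] show "G m x \<le> G (Suc m) x" unfolding G_max by (rule max.mono) simp
  qed
  have SUP_G: "l_rob l A \<delta> \<beta> lam x = (SUP m. ereal (G m x))" for x
  proof (rule antisym)
    have "l_rob l A \<delta> \<beta> lam x = (SUP m. ereal (F l A \<delta> (g m x) \<beta> lam x))"
      by (rule l_rob_SUP_argmax, rule g_max)
    also have "\<dots> \<le> (SUP m. ereal (G m x))" by (intro SUP_mono') (simp add: G_max)
    finally show "l_rob l A \<delta> \<beta> lam x \<le> (SUP m. ereal (G m x))" .
    show "(SUP m. ereal (G m x)) \<le> l_rob l A \<delta> \<beta> lam x"
      unfolding G_def by (rule SUP_least) (rule F_le_l_rob)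
  qed
  let ?R = "l_rob l A \<delta> \<beta> lam"
  have R_ge: "ereal (- h x) \<le> ?R x" for x
    unfolding h_def F0_def by (rule order_trans[OF _ F_le_l_rob[of l "g\<^sub>0 x"]]) auto
  \<comment> \<open>Adding \<open>h\<close> makes \<open>l_rob\<close> nonnegative, so the supremum
    of the truncated problems passes through the conversion to \<open>ennreal\<close>; the negative
    part again goes to the other side.\<close>
  have split: "e2ennreal (?R x) + ennreal (h x) = (SUP m. ennreal (G m x + h x)) + e2ennreal (- ?R x)" for x
  proof -
    have "(SUP m. ennreal (G m x + h x)) = (SUP m. e2ennreal (ereal (G m x) + ereal (h x)))" by simp
    also have "\<dots> = e2ennreal (SUP m. ereal (G m x) + ereal (h x))"
      using inc[of x] by (intro e2ennreal_SUP[symmetric]) (auto simp: mono_def)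
    also have "\<dots> = e2ennreal (?R x + ereal (h x))"
      unfolding SUP_G by (subst SUP_ereal_add_left) auto
    finally have sup: "(SUP m. ennreal (G m x + h x)) = e2ennreal (?R x + ereal (h x))" .
    show ?thesis unfolding sup
    proof (cases "?R x")
      case (real r)
      have "0 \<le> r + h x" using R_ge[of x] by (simp add: real)
      then show "e2ennreal (?R x) + ennreal (h x) = e2ennreal (?R x + ereal (h x)) + e2ennreal (- ?R x)"
        using h(1)[of x] by (cases "0 \<le> r") (simp_all add: real ennreal_neg ennreal_plus[symmetric] del: ennreal_plus)
    next
      case PInf then show "e2ennreal (?R x) + ennreal (h x) = e2ennreal (?R x + ereal (h x)) + e2ennreal (- ?R x)"
        by simp
    next
      case MInf then show "e2ennreal (?R x) + ennreal (h x) = e2ennreal (?R x + ereal (h x)) + e2ennreal (- ?R x)"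
        using R_ge[of x] by simp
    qed
  qed
  have "(\<integral>\<^sup>+ x. (SUP m. ennreal (G m x + h x)) \<partial>P\<^sub>0) = (SUP m. \<integral>\<^sup>+ x. ennreal (G m x + h x) \<partial>P\<^sub>0)"
  proof (rule nn_integral_monotone_convergence_SUP)
    show "incseq (\<lambda>m x. ennreal (G m x + h x))"
      using inc by (intro monoI le_funI ennreal_leI) (auto simp: mono_def)
  qed measurable
  also have "\<dots> \<le> ennreal (M + H)" by (rule SUP_least) (rule X_le)
  finally have Y: "(\<integral>\<^sup>+ x. (SUP m. ennreal (G m x + h x)) \<partial>P\<^sub>0) \<le> ennreal (M + H)" .
  have "(\<integral>\<^sup>+ x. e2ennreal (?R x) \<partial>P\<^sub>0) + ennreal H = (\<integral>\<^sup>+ x. e2ennreal (?R x) + ennreal (h x) \<partial>P\<^sub>0)"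
    unfolding H(1)[symmetric] by (simp add: nn_integral_add)
  also have "\<dots> = (\<integral>\<^sup>+ x. (SUP m. ennreal (G m x + h x)) \<partial>P\<^sub>0) + (\<integral>\<^sup>+ x. e2ennreal (- ?R x) \<partial>P\<^sub>0)"
    unfolding split by (intro nn_integral_add) measurable
  also have "\<dots> \<le> ennreal (M + H) + (\<integral>\<^sup>+ x. e2ennreal (- ?R x) \<partial>P\<^sub>0)"
    by (intro add_mono Y order_refl)
  finally have main: "(\<integral>\<^sup>+ x. e2ennreal (?R x) \<partial>P\<^sub>0) + ennreal H \<le> ennreal (M + H) + (\<integral>\<^sup>+ x. e2ennreal (- ?R x) \<partial>P\<^sub>0)" .
  have "(\<integral>\<^sup>+ x. e2ennreal (- ?R x) \<partial>P\<^sub>0) \<le> (\<integral>\<^sup>+ x. ennreal (h x) \<partial>P\<^sub>0)"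
  proof (rule nn_integral_mono)
    fix x
    have "- ?R x \<le> ereal (h x)" using R_ge[of x] by (metis ereal_minus_le_minus ereal_uminus_uminus uminus_ereal.simps(1))
    from e2ennreal_mono[OF this] show "e2ennreal (- ?R x) \<le> ennreal (h x)" by simp
  qed
  then have "(\<integral>\<^sup>+ x. e2ennreal (- ?R x) \<partial>P\<^sub>0) \<le> ennreal H" unfolding H(1) .
  then obtain n where n: "(\<integral>\<^sup>+ x. e2ennreal (- ?R x) \<partial>P\<^sub>0) = ennreal n" "0 \<le> n"
    by (cases "\<integral>\<^sup>+ x. e2ennreal (- ?R x) \<partial>P\<^sub>0") (auto simp: top_unique)
  have "(\<integral>\<^sup>+ x. e2ennreal (?R x) \<partial>P\<^sub>0) + ennreal H \<le> ennreal (M + H + n)"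
    using main MH n by (simp add: ennreal_plus)
  then obtain p where p: "(\<integral>\<^sup>+ x. e2ennreal (?R x) \<partial>P\<^sub>0) = ennreal p" "0 \<le> p" "p + H \<le> M + H + n"
    using MH n H by (cases "\<integral>\<^sup>+ x. e2ennreal (?R x) \<partial>P\<^sub>0")
      (auto simp: top_unique ennreal_plus[symmetric] ennreal_le_iff simp del: ennreal_plus)
  have "f_dual l A P\<^sub>0 \<delta> \<beta> lam \<le> ereal M"
    unfolding f_dual_def expect_def using p n by (simp add: enn2ereal_ennreal)
  with lam(1) show thesis by (rule that)
qed

end

subsection \<open>Existence of a dual optimizer\<close>

lemma usc_pos_part: "usc l \<Longrightarrow> usc (\<lambda>t. max 0 (l t))"
  unfolding usc_def by (auto elim: eventually_mono)

context quadratic_transport begin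

lemma l_rob_neq_MInf: "l_rob l A \<delta> \<beta> lam x \<noteq> -\<infinity>"
  using F_le_l_rob[of l 0 lam x] by auto

text \<open>A geometric mixture of couplings with gains \<open>2\<^sup>n\<close> is feasible and has infinite gain.\<close>

lemma worst_case_infinite:
  assumes l: "usc l" and unbounded: "\<And>M. \<exists>v>M. achieves (\<lambda>t. max 0 (l t)) \<delta> v"
  shows "worst_case l c P\<^sub>0 \<delta> \<beta> = \<infinity>"
proof -
  note [measurable] = usc_borel_measurable[OF l] c_measurable measurable_fst_snd
  define good where "good n \<pi> \<longleftrightarrow> borel_prob \<pi> \<and> distr \<pi> borel fst = P\<^sub>0 \<and>
      (\<integral>\<^sup>+ z. ennreal (c (fst z) (snd z)) \<partial>\<pi>) \<le> ennreal \<delta> \<and>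
      ennreal (2 ^ Suc n) \<le> (\<integral>\<^sup>+ z. ennreal (l (\<beta> \<bullet> snd z)) \<partial>\<pi>)" for n \<pi>
  have "\<exists>\<pi>. good n \<pi>" for n
  proof -
    obtain v \<pi> a b where "2 ^ Suc n < v" and \<pi>: "borel_prob \<pi>" "distr \<pi> borel fst = P\<^sub>0"
      "(\<integral>\<^sup>+ z. ennreal (c (fst z) (snd z)) \<partial>\<pi>) \<le> ennreal \<delta>"
      and ab: "0 \<le> b" "ennreal a \<le> (\<integral>\<^sup>+ z. ennreal (max 0 (l (\<beta> \<bullet> snd z))) \<partial>\<pi>)" "v \<le> a - b"
      using unbounded[of "2 ^ Suc n"] unfolding achieves_def by blast
    then have "2 ^ Suc n \<le> a" by linarith
    then have "ennreal (2 ^ Suc n) \<le> ennreal a" by (rule ennreal_leI)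
    also have "\<dots> \<le> (\<integral>\<^sup>+ z. ennreal (l (\<beta> \<bullet> snd z)) \<partial>\<pi>)" using ab(2) by simp
    finally have "good n \<pi>" unfolding good_def using \<pi> by (intro conjI)
    then show ?thesis ..
  qed
  then have "\<exists>K. \<forall>n. good n (K n)" by (intro choice allI)
  then obtain K where "\<And>n. good n (K n)" by blast
  then have K: "\<And>n. borel_prob (K n)" "\<And>n. distr (K n) borel fst = P\<^sub>0"
    "\<And>n. (\<integral>\<^sup>+ z. ennreal (c (fst z) (snd z)) \<partial>K n) \<le> ennreal \<delta>"
    "\<And>n. ennreal (2 ^ Suc n) \<le> (\<integral>\<^sup>+ z. ennreal (l (\<beta> \<bullet> snd z)) \<partial>K n)"
    unfolding good_def by auto
  define p where "p = geometric_pmf (1/2)"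
  define \<mu> where "\<mu> = measure_pmf p \<bind> K"
  have \<mu>: "borel_prob \<mu>" unfolding \<mu>_def by (rule borel_prob_bind_pmf) (rule K)
  have int: "(\<integral>\<^sup>+ z. f z \<partial>\<mu>) = (\<integral>\<^sup>+ n. \<integral>\<^sup>+ z. f z \<partial>K n \<partial>measure_pmf p)" if "f \<in> borel_measurable borel" for f
    unfolding \<mu>_def by (rule nn_integral_bind_pmf_kernel[of K, OF K(1) that])
  have marg: "distr \<mu> borel fst = P\<^sub>0"
    unfolding \<mu>_def by (rule distr_bind_pmf_const[OF K(1) measurable_fst_snd(1) K(2) P0])
  have "(\<integral>\<^sup>+ z. ennreal (c (fst z) (snd z)) \<partial>\<mu>) = (\<integral>\<^sup>+ n. \<integral>\<^sup>+ z. ennreal (c (fst z) (snd z)) \<partial>K n \<partial>measure_pmf p)"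
    by (rule int) measurable
  also have "\<dots> \<le> (\<integral>\<^sup>+ n. ennreal \<delta> \<partial>measure_pmf p)" by (intro nn_integral_mono K)
  finally have cost: "(\<integral>\<^sup>+ z. ennreal (c (fst z) (snd z)) \<partial>\<mu>) \<le> ennreal \<delta>" by simp
  have "(\<infinity>::ennreal) = (\<integral>\<^sup>+ n. 1 \<partial>count_space (UNIV :: nat set))" by simp
  also have "\<dots> \<le> (\<integral>\<^sup>+ n. ennreal (pmf p n) * (\<integral>\<^sup>+ z. ennreal (l (\<beta> \<bullet> snd z)) \<partial>K n) \<partial>count_space UNIV)"
  proof (rule nn_integral_mono)
    fix n
    \<comment> \<open>The weight of n is \<open>(1/2) ^ Suc n\<close> and its gain is at least
      \<open>2 ^ Suc n\<close>, so every term of the series is at least 1.\<close>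
    have "(1::real) = (1/2) ^ Suc n * 2 ^ Suc n" by (simp only: power_mult_distrib[symmetric]) simp
    then have "(1::ennreal) = ennreal ((1/2) ^ Suc n * 2 ^ Suc n)" by (simp only: ennreal_1)
    also have "\<dots> = ennreal (pmf p n) * ennreal (2 ^ Suc n)"
      by (subst ennreal_mult) (simp_all add: p_def pmf_geometric mult.commute)
    also have "\<dots> \<le> ennreal (pmf p n) * (\<integral>\<^sup>+ z. ennreal (l (\<beta> \<bullet> snd z)) \<partial>K n)"
      by (intro mult_left_mono K) simp
    finally show "1 \<le> ennreal (pmf p n) * (\<integral>\<^sup>+ z. ennreal (l (\<beta> \<bullet> snd z)) \<partial>K n)" .
  qed
  also have "\<dots> = (\<integral>\<^sup>+ z. ennreal (l (\<beta> \<bullet> snd z)) \<partial>\<mu>)"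
    unfolding nn_integral_measure_pmf[symmetric] by (rule int[symmetric]) measurable
  also have "\<dots> = (\<integral>\<^sup>+ x. ennreal (l (\<beta> \<bullet> x)) \<partial>distr \<mu> borel snd)"
    by (rule nn_integral_snd_marginal[OF \<mu>, symmetric]) measurable
  \<comment> \<open>An infinite positive part gives expectation \<infinity> whatever the negative
    part, so the latter is not estimated.\<close>
  finally have "expect (distr \<mu> borel snd) (\<lambda>x. ereal (l (\<beta> \<bullet> x))) = \<infinity>"
    by (intro expect_eq_top) (simp add: top_unique)
  with snd_marginal_feasible[OF \<mu> marg cost, of l] show ?thesis by simp
qed

text \<open>Two multipliers at distance 1 control the cost: \<open>F\<close> at the smaller one
  exceeds \<open>F\<close> at the larger one by
  \<open>sqrt \<delta> * (\<gamma>\<^sup>2 * s x - 1)\<close>. A plan for which the larger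
  multiplier gives a value with integrable negative part thus has its cost bounded by the positive
  part of \<open>l_rob\<close> at the smaller multiplier and that negative part.\<close>

lemma finite_cost_plan:
  assumes l: "usc l" and lam\<^sub>0: "0 \<le> lam\<^sub>0" "f_dual l A P\<^sub>0 \<delta> \<beta> lam\<^sub>0 \<noteq> \<infinity>"
    and not_bot: "f_dual l A P\<^sub>0 \<delta> \<beta> (lam\<^sub>0 + 1) \<noteq> -\<infinity>"
  obtains g where "g \<in> borel_measurable borel"
    "(\<integral>\<^sup>+ x. ennreal (\<delta> * (g x)\<^sup>2 * s x) \<partial>P\<^sub>0) < \<infinity>"
    "(\<integral>\<^sup>+ x. ennreal (- l (\<beta> \<bullet> x + g x * sqrt \<delta> * s x)) \<partial>P\<^sub>0) < \<infinity>"
proof -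
  note [measurable] = usc_borel_measurable[OF l] l_rob_measurable[OF l]
  let ?q = "sqrt \<delta>" and ?R0 = "l_rob l A \<delta> \<beta> lam\<^sub>0" and ?R1 = "l_rob l A \<delta> \<beta> (lam\<^sub>0 + 1)"
  have q: "0 < ?q" "?q * ?q = \<delta>" using delta by auto
  have F_diff: "F l A \<delta> t \<beta> lam\<^sub>0 x = F l A \<delta> t \<beta> (lam\<^sub>0 + 1) x + ?q * (t\<^sup>2 * s x - 1)" for t x
    by (simp add: F_eq algebra_simps)
  have R0_fin: "(\<integral>\<^sup>+ x. e2ennreal (?R0 x) \<partial>P\<^sub>0) < \<infinity>"
    using lam\<^sub>0(2) expect_eq_top[of P\<^sub>0 ?R0] unfolding f_dual_def infinity_ennreal_def
      top.not_eq_extremum[symmetric] by blast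
  \<comment> \<open>This makes the positive part of \<open>?R1\<close> integrable; as the dual value
    at the larger multiplier is not -\<infinity>, the negative part is integrable too.\<close>
  have "?R1 x \<le> ?R0 x + ereal ?q" for x
    unfolding l_rob_def[of l A \<delta> \<beta> "lam\<^sub>0 + 1"]
  proof (rule SUP_least)
    fix t
    have "0 \<le> ?q * (t\<^sup>2 * s x)" using q s_nonneg[of x] by simp
    then have "ereal (F l A \<delta> t \<beta> (lam\<^sub>0 + 1) x) \<le> ereal (F l A \<delta> t \<beta> lam\<^sub>0 x) + ereal ?q"
      unfolding F_diff by (simp add: right_diff_distrib)
    also have "\<dots> \<le> ?R0 x + ereal ?q" by (intro add_mono F_le_l_rob order_refl)
    finally show "ereal (F l A \<delta> t \<beta> (lam\<^sub>0 + 1) x) \<le> ?R0 x + ereal ?q" .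
  qed
  then have "e2ennreal (?R1 x) \<le> e2ennreal (?R0 x + ereal ?q)" for x by (rule e2ennreal_mono)
  moreover have "e2ennreal (?R0 x + ereal ?q) \<le> e2ennreal (?R0 x) + ennreal ?q" for x
  proof (cases "?R0 x")
    case (real r)
    have "ennreal (r + ?q) \<le> ennreal (max 0 r + ?q)" by (intro ennreal_leI) auto
    also have "\<dots> = ennreal r + ennreal ?q" using q by (simp add: ennreal_plus)
    finally show ?thesis by (simp add: real)
  qed (simp_all add: l_rob_neq_MInf)
  ultimately have "(\<integral>\<^sup>+ x. e2ennreal (?R1 x) \<partial>P\<^sub>0) \<le> (\<integral>\<^sup>+ x. e2ennreal (?R0 x) + ennreal ?q \<partial>P\<^sub>0)"
    by (intro nn_integral_mono) (rule order_trans)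
  also have "\<dots> < \<infinity>" using R0_fin by (simp add: nn_integral_add P0.emeasure_space_1)
  finally have R1_fin: "(\<integral>\<^sup>+ x. e2ennreal (- ?R1 x) \<partial>P\<^sub>0) < \<infinity>"
    using not_bot expect_eq_bot[of P\<^sub>0 ?R1] unfolding f_dual_def infinity_ennreal_def
      top.not_eq_extremum[symmetric] by blast
  define N where "N x = enn2real (e2ennreal (- ?R1 x))" for x
  have N_m[measurable]: "N \<in> borel_measurable borel" unfolding N_def by measurable
  have N: "e2ennreal (- ?R1 x) = ennreal (N x)" "0 \<le> N x" "ereal (- N x) \<le> ?R1 x" for x
  proof -
    show "0 \<le> N x" by (simp add: N_def)
    have "e2ennreal (- ?R1 x) = ennreal (N x) \<and> ereal (- N x) \<le> ?R1 x"
    proof (cases "?R1 x")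
      case (real r)
      then show ?thesis by (cases "0 \<le> r") (simp_all add: N_def ennreal_neg)
    qed (simp_all add: N_def e2ennreal_neg l_rob_neq_MInf)
    then show "e2ennreal (- ?R1 x) = ennreal (N x)" "ereal (- N x) \<le> ?R1 x" by simp_all
  qed
  obtain g :: "nat \<Rightarrow> real^'n \<Rightarrow> real" where g[measurable]: "\<And>m. g m \<in> borel_measurable borel"
    and g_max: "\<And>m x t. \<bar>t\<bar> \<le> real m \<Longrightarrow> F l A \<delta> t \<beta> (lam\<^sub>0 + 1) x \<le> F l A \<delta> (g m x) \<beta> (lam\<^sub>0 + 1) x"
    by (rule F_argmax[OF l, of "lam\<^sub>0 + 1"]) blast
  \<comment> \<open>The slack 1 guarantees such an index, since the supremum over m need not be
    attained. Taking the least index keeps the choice measurable.\<close>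
  define m where "m x = (LEAST m. - N x - 1 \<le> F l A \<delta> (g m x) \<beta> (lam\<^sub>0 + 1) x)" for x
  define g' where "g' x = g (m x) x" for x
  have [measurable]: "(\<lambda>x. F l A \<delta> (g m x) \<beta> (lam\<^sub>0 + 1) x) \<in> borel_measurable borel" for m
    by (rule F_measurable[OF l g])
  have "m \<in> measurable borel (count_space UNIV)" unfolding m_def by measurable
  then have g'_m[measurable]: "g' \<in> borel_measurable borel"
    unfolding g'_def by (rule measurable_compose_countable[OF g])
  have F1: "- N x - 1 \<le> F l A \<delta> (g' x) \<beta> (lam\<^sub>0 + 1) x" for x
  proof -
    have "ereal (- N x - 1) < ereal (- N x)" by simp
    also have "\<dots> \<le> ?R1 x" by (rule N)
    also have "\<dots> = (SUP m. ereal (F l A \<delta> (g m x) \<beta> (lam\<^sub>0 + 1) x))"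
      by (rule l_rob_SUP_argmax, rule g_max)
    finally obtain k where "- N x - 1 < F l A \<delta> (g k x) \<beta> (lam\<^sub>0 + 1) x"
      unfolding less_SUP_iff by auto
    then have "- N x - 1 \<le> F l A \<delta> (g k x) \<beta> (lam\<^sub>0 + 1) x" by simp
    then show ?thesis
      unfolding g'_def m_def by (rule LeastI[of "\<lambda>m. - N x - 1 \<le> F l A \<delta> (g m x) \<beta> (lam\<^sub>0 + 1) x"])
  qed
  have "ennreal (\<delta> * (g' x)\<^sup>2 * s x) \<le> ennreal ?q * (e2ennreal (?R0 x) + ennreal (N x)) + ennreal (\<delta> + ?q)" for x
  proof (cases "?R0 x")
    case (real r)
    have "F l A \<delta> (g' x) \<beta> lam\<^sub>0 x \<le> r" using F_le_l_rob[of l "g' x" lam\<^sub>0 x] by (simp add: real)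
    with F1[of x] have "?q * ((g' x)\<^sup>2 * s x - 1) \<le> max 0 r + N x + 1" unfolding F_diff by linarith
    then have "?q * (?q * ((g' x)\<^sup>2 * s x - 1)) \<le> ?q * (max 0 r + N x + 1)"
      using q by (intro mult_left_mono) auto
    also have "?q * (?q * ((g' x)\<^sup>2 * s x - 1)) = \<delta> * (g' x)\<^sup>2 * s x - \<delta>"
      unfolding mult.assoc[symmetric] q(2) by (simp add: algebra_simps)
    finally have "ennreal (\<delta> * (g' x)\<^sup>2 * s x) \<le> ennreal (?q * (max 0 r + N x) + (\<delta> + ?q))"
      by (intro ennreal_leI) (simp add: algebra_simps)
    also have "\<dots> = ennreal ?q * (ennreal r + ennreal (N x)) + ennreal (\<delta> + ?q)"
      using q N(2)[of x] delta by (subst ennreal_plus) (simp_all add: ennreal_mult ennreal_plus)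
    finally show ?thesis by (simp add: real)
  next
    case PInf then show ?thesis using q by (simp add: ennreal_mult_top)
  qed (simp add: l_rob_neq_MInf)
  then have "(\<integral>\<^sup>+ x. ennreal (\<delta> * (g' x)\<^sup>2 * s x) \<partial>P\<^sub>0)
      \<le> (\<integral>\<^sup>+ x. ennreal ?q * (e2ennreal (?R0 x) + ennreal (N x)) + ennreal (\<delta> + ?q) \<partial>P\<^sub>0)"
    by (rule nn_integral_mono)
  also have "\<dots> = ennreal ?q * ((\<integral>\<^sup>+ x. e2ennreal (?R0 x) \<partial>P\<^sub>0) + (\<integral>\<^sup>+ x. e2ennreal (- ?R1 x) \<partial>P\<^sub>0)) + ennreal (\<delta> + ?q)"
    unfolding N(1) by (simp add: nn_integral_add nn_integral_cmult P0.emeasure_space_1)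
  also have "\<dots> < \<infinity>" using R0_fin R1_fin by (simp add: ennreal_mult_less_top)
  finally have cost: "(\<integral>\<^sup>+ x. ennreal (\<delta> * (g' x)\<^sup>2 * s x) \<partial>P\<^sub>0) < \<infinity>" .
  let ?k = "1 + (lam\<^sub>0 + 1) * ?q"
  have "ennreal (- l (\<beta> \<bullet> x + g' x * ?q * s x)) \<le> ennreal (N x) + ennreal ?k" for x
  proof -
    have "0 \<le> (lam\<^sub>0 + 1) * ?q * ((g' x)\<^sup>2 * s x)" using q lam\<^sub>0 s_nonneg[of x] by simp
    then have "- l (\<beta> \<bullet> x + g' x * ?q * s x) \<le> N x + ?k"
      using F1[of x] unfolding F_eq right_diff_distrib by simp
    then have "ennreal (- l (\<beta> \<bullet> x + g' x * ?q * s x)) \<le> ennreal (N x + ?k)" by (rule ennreal_leI)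
    then show ?thesis using N(2)[of x] q lam\<^sub>0 by (subst ennreal_plus[symmetric]) auto
  qed
  then have "(\<integral>\<^sup>+ x. ennreal (- l (\<beta> \<bullet> x + g' x * ?q * s x)) \<partial>P\<^sub>0) \<le> (\<integral>\<^sup>+ x. e2ennreal (- ?R1 x) + ennreal ?k \<partial>P\<^sub>0)"
    unfolding N(1) by (rule nn_integral_mono)
  also have "\<dots> < \<infinity>" using R1_fin by (simp add: nn_integral_add P0.emeasure_space_1)
  finally show thesis by (rule that[OF g'_m cost])
qed

text \<open>Where \<open>l (\<beta> \<bullet> x)\<close> is at most k in absolute value the point
  stays, with negative part at most k. The cost of moving the others tends to 0 by dominated
  convergence as k grows, so some k brings it below \<delta>.\<close>

lemma truncate_plan:
  assumes l: "usc l" and g[measurable]: "g \<in> borel_measurable borel"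
    and cost: "(\<integral>\<^sup>+ x. ennreal (\<delta> * (g x)\<^sup>2 * s x) \<partial>P\<^sub>0) < \<infinity>"
    and neg: "(\<integral>\<^sup>+ x. ennreal (- l (\<beta> \<bullet> x + g x * sqrt \<delta> * s x)) \<partial>P\<^sub>0) < \<infinity>"
  obtains g' where "g' \<in> borel_measurable borel"
    "(\<integral>\<^sup>+ x. ennreal (\<delta> * (g' x)\<^sup>2 * s x) \<partial>P\<^sub>0) < ennreal \<delta>"
    "(\<integral>\<^sup>+ x. ennreal (- l (\<beta> \<bullet> x + g' x * sqrt \<delta> * s x)) \<partial>P\<^sub>0) < \<infinity>"
proof -
  note [measurable] = usc_borel_measurable[OF l]
  define t where "t k x = (if \<bar>l (\<beta> \<bullet> x)\<bar> \<le> real k then 0 else g x)" for k x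
  have t_m[measurable]: "t k \<in> borel_measurable borel" for k unfolding t_def by measurable
  have "(\<lambda>k. \<integral>\<^sup>+ x. ennreal (\<delta> * (t k x)\<^sup>2 * s x) \<partial>P\<^sub>0) \<longlonglongrightarrow> (\<integral>\<^sup>+ x. 0 \<partial>P\<^sub>0)"
  proof (rule nn_integral_dominated_convergence[OF _ _ _ _ cost])
    show "AE x in P\<^sub>0. ennreal (\<delta> * (t k x)\<^sup>2 * s x) \<le> ennreal (\<delta> * (g x)\<^sup>2 * s x)" for k
      using delta by (intro AE_I2) (auto simp: t_def)
    show "AE x in P\<^sub>0. (\<lambda>k. ennreal (\<delta> * (t k x)\<^sup>2 * s x)) \<longlonglongrightarrow> 0"
    proof (intro AE_I2 tendsto_eventually)
      fix x
      obtain n :: nat where "\<bar>l (\<beta> \<bullet> x)\<bar> \<le> real n" using real_arch_simple by blast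
      then show "\<forall>\<^sub>F k in sequentially. ennreal (\<delta> * (t k x)\<^sup>2 * s x) = 0"
        by (intro eventually_sequentiallyI[of n]) (auto simp: t_def)
    qed
  qed measurable
  then have "\<forall>\<^sub>F k in sequentially. (\<integral>\<^sup>+ x. ennreal (\<delta> * (t k x)\<^sup>2 * s x) \<partial>P\<^sub>0) < ennreal \<delta>"
    using delta by (intro order_tendstoD) auto
  then obtain k where k: "(\<integral>\<^sup>+ x. ennreal (\<delta> * (t k x)\<^sup>2 * s x) \<partial>P\<^sub>0) < ennreal \<delta>"
    by (auto simp: eventually_sequentially)
  have "ennreal (- l (\<beta> \<bullet> x + t k x * sqrt \<delta> * s x))
      \<le> ennreal (real k) + ennreal (- l (\<beta> \<bullet> x + g x * sqrt \<delta> * s x))" for x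
    by (auto simp: t_def intro!: ennreal_leI add_increasing add_increasing2)
  then have "(\<integral>\<^sup>+ x. ennreal (- l (\<beta> \<bullet> x + t k x * sqrt \<delta> * s x)) \<partial>P\<^sub>0)
      \<le> (\<integral>\<^sup>+ x. ennreal (real k) + ennreal (- l (\<beta> \<bullet> x + g x * sqrt \<delta> * s x)) \<partial>P\<^sub>0)"
    by (rule nn_integral_mono)
  also have "\<dots> < \<infinity>" using neg by (simp add: nn_integral_add P0.emeasure_space_1)
  finally show thesis by (rule that[OF t_m k])
qed

lemma dual_optimizer:
  assumes l: "usc l"
  obtains lam where "0 \<le> lam" "f_dual l A P\<^sub>0 \<delta> \<beta> lam \<le> worst_case l c P\<^sub>0 \<delta> \<beta>"
proof -
  consider (bot) lam where "0 \<le> lam" "f_dual l A P\<^sub>0 \<delta> \<beta> lam = -\<infinity>"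
    | (top) "\<And>lam. 0 \<le> lam \<Longrightarrow> f_dual l A P\<^sub>0 \<delta> \<beta> lam = \<infinity>"
    | (finite) lam\<^sub>0 where "0 \<le> lam\<^sub>0" "f_dual l A P\<^sub>0 \<delta> \<beta> lam\<^sub>0 \<noteq> \<infinity>"
        "f_dual l A P\<^sub>0 \<delta> \<beta> (lam\<^sub>0 + 1) \<noteq> -\<infinity>"
    \<comment> \<open>If neither of the first two cases holds, some multiplier has dual value other
      than \<infinity>, and the value at its successor is not -\<infinity>.\<close>
    by (metis add_nonneg_nonneg zero_le_one)
  then show thesis
  proof cases
    case bot
    then show ?thesis using that by auto
  next
    case top
    let ?l = "\<lambda>t. max 0 (l t)"
    have "worst_case l c P\<^sub>0 \<delta> \<beta> = \<infinity>"
    proof (rule worst_case_infinite[OF l], rule ccontr)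
      fix M assume "\<not> (\<exists>v>M. achieves ?l \<delta> v)"
      then have M: "\<And>v. achieves ?l \<delta> v \<Longrightarrow> v \<le> M" by (meson not_le)
      obtain lam where lam: "0 \<le> lam" "f_dual ?l A P\<^sub>0 \<delta> \<beta> lam \<le> ereal M"
        \<comment> \<open>For the positive part of \<open>l\<close> the plan that moves nothing has
          cost 0 and no negative part, so it can serve as the base plan.\<close>
        by (rule dual_le_achievable_bound[OF usc_pos_part[OF l], of "\<lambda>_. 0" M])
          (simp_all add: ennreal_neg delta M)
      have "l_rob l A \<delta> \<beta> lam x \<le> l_rob ?l A \<delta> \<beta> lam x" for x
        unfolding l_rob_def by (intro SUP_mono') (simp add: F_eq)
      then have "(\<integral>\<^sup>+ x. e2ennreal (l_rob l A \<delta> \<beta> lam x) \<partial>P\<^sub>0) \<le> (\<integral>\<^sup>+ x. e2ennreal (l_rob ?l A \<delta> \<beta> lam x) \<partial>P\<^sub>0)"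
        by (intro nn_integral_mono e2ennreal_mono)
      moreover have "(\<integral>\<^sup>+ x. e2ennreal (l_rob l A \<delta> \<beta> lam x) \<partial>P\<^sub>0) = \<infinity>"
        using top[OF lam(1)] unfolding f_dual_def by (rule expect_eq_topD)
      ultimately have "f_dual ?l A P\<^sub>0 \<delta> \<beta> lam = \<infinity>"
        unfolding f_dual_def by (intro expect_eq_top) (simp add: top_unique)
      with lam(2) show False by simp
    qed
    then show ?thesis using that[of 0] by simp
  next
    case finite
    obtain g where g: "g \<in> borel_measurable borel"
      "(\<integral>\<^sup>+ x. ennreal (\<delta> * (g x)\<^sup>2 * s x) \<partial>P\<^sub>0) < \<infinity>"
      "(\<integral>\<^sup>+ x. ennreal (- l (\<beta> \<bullet> x + g x * sqrt \<delta> * s x)) \<partial>P\<^sub>0) < \<infinity>"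
      using finite_cost_plan[OF l finite] by blast
    obtain g' where g': "g' \<in> borel_measurable borel"
      "(\<integral>\<^sup>+ x. ennreal (\<delta> * (g' x)\<^sup>2 * s x) \<partial>P\<^sub>0) < ennreal \<delta>"
      "(\<integral>\<^sup>+ x. ennreal (- l (\<beta> \<bullet> x + g' x * sqrt \<delta> * s x)) \<partial>P\<^sub>0) < \<infinity>"
      using truncate_plan[OF l g] by blast
    obtain n where n: "(\<integral>\<^sup>+ x. ennreal (- l (\<beta> \<bullet> x + g' x * sqrt \<delta> * s x)) \<partial>P\<^sub>0) = ennreal n" "0 \<le> n"
      using g'(3) by (cases "\<integral>\<^sup>+ x. ennreal (- l (\<beta> \<bullet> x + g' x * sqrt \<delta> * s x)) \<partial>P\<^sub>0") auto
    \<comment> \<open>The truncated plan keeps the worst case above -\<infinity>, and weak duality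
      at \<open>lam\<^sub>0\<close> keeps it below \<infinity>; hence it is a real number M bounding
      all achieved values.\<close>
    have "achieves l \<delta> (0 - n)"
      using delta g'(2) n by (intro achieves_move[OF l g'(1)]) auto
    then have "worst_case l c P\<^sub>0 \<delta> \<beta> \<noteq> -\<infinity>" using achieves_le_worst_case[OF l] by force
    moreover have "worst_case l c P\<^sub>0 \<delta> \<beta> \<noteq> \<infinity>"
      using weak_duality[OF l finite(1)] finite(2) by auto
    ultimately obtain M where M: "worst_case l c P\<^sub>0 \<delta> \<beta> = ereal M"
      by (cases "worst_case l c P\<^sub>0 \<delta> \<beta>") auto
    have "v \<le> M" if "achieves l \<delta> v" for v
      using achieves_le_worst_case[OF l that] by (simp add: M)
    then show ?thesis
      by (rule dual_le_achievable_bound[OF l g']) (use that M in simp_all)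
  qed
qed

end

theorem theorem1:
  fixes l :: "real \<Rightarrow> real"
    and c :: "real^'n \<Rightarrow> real^'n \<Rightarrow> real"
    and A :: "real^'n \<Rightarrow> real^'n^'n"
    and P\<^sub>0 :: "(real^'n) measure"
    and B :: "(real^'n) set"
    and \<delta> \<rho>min \<rho>max :: real
  assumes "convex B"
    and "\<delta> > 0"
    and "borel_prob P\<^sub>0"
    and "usc l"
    and "\<And>x. spd (A x)"
    and "\<And>x x'. c x x' = (x - x') \<bullet> (A x *v (x - x'))"
    and "lsc (\<lambda>(x, x'). c x x')"
    and "\<rho>min > 0" and "\<rho>max > 0"
    and "AE x in P\<^sub>0. (SUP v\<in>{v. norm v = 1}. v \<bullet> (A x *v v)) \<le> \<rho>max"
    and "AE x in P\<^sub>0. (INF v\<in>{v. norm v = 1}. v \<bullet> (A x *v v)) \<ge> \<rho>min"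
  shows "(\<forall>\<beta>\<in>B. worst_case l c P\<^sub>0 \<delta> \<beta> = (INF lam\<in>{0..}. f_dual l A P\<^sub>0 \<delta> \<beta> lam)) \<and>
    (\<forall>\<beta>\<in>B. \<exists>lams\<ge>0. f_dual l A P\<^sub>0 \<delta> \<beta> lams = (INF lam\<in>{0..}. f_dual l A P\<^sub>0 \<delta> \<beta> lam))"
proof -
  have "worst_case l c P\<^sub>0 \<delta> \<beta> = (INF lam\<in>{0..}. f_dual l A P\<^sub>0 \<delta> \<beta> lam) \<and>
    (\<exists>lams\<ge>0. f_dual l A P\<^sub>0 \<delta> \<beta> lams = (INF lam\<in>{0..}. f_dual l A P\<^sub>0 \<delta> \<beta> lam))" for \<beta>
  proof -
    interpret quadratic_transport c A P\<^sub>0 \<delta> \<rho>min \<beta>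
      using assms by unfold_locales
    obtain lam where lam: "0 \<le> lam" "f_dual l A P\<^sub>0 \<delta> \<beta> lam \<le> worst_case l c P\<^sub>0 \<delta> \<beta>"
      by (rule dual_optimizer[OF assms(4)])
    have weak: "worst_case l c P\<^sub>0 \<delta> \<beta> \<le> (INF lam\<in>{0..}. f_dual l A P\<^sub>0 \<delta> \<beta> lam)"
      by (rule INF_greatest) (simp add: weak_duality[OF assms(4)])
    have inf: "(INF lam\<in>{0..}. f_dual l A P\<^sub>0 \<delta> \<beta> lam) \<le> f_dual l A P\<^sub>0 \<delta> \<beta> lam"
      by (rule INF_lower) (simp add: lam)
    \<comment> \<open>The worst case is at most the infimum, the infimum at most the dual value at
      \<open>lam\<close>, and this at most the worst case. All three agree, which gives both duality
      and attainment.\<close>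
    show ?thesis
      using lam(1) antisym[OF weak order_trans[OF inf lam(2)]]
        antisym[OF order_trans[OF lam(2) weak] inf] by blast
  qed
  then show ?thesis by blast
qed

end
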